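(* Let $\mathbb{I}=\{S_i\}_{i=1}^N$ be an affine IFS on $\mathbb{R}^2$ with affinity dimension $s\le 2$, let $C\subset\mathbb{R}^2$ be a non-empty compact condensation set such that the condensation open set condition (COSC) is satisfied, and let $F_C\subset\mathbb{R}^2$ be the inhomogeneous self-affine set of $\mathbb{I}$ with condensation set $C$. If $C$ has a connected component not contained in a (straight) line, then $$\overline{\dim}_{\mathrm{B}}F_C=\max\{s,\ \overline{\dim}_{\mathrm{B}}C\}$$ and $$\max\{s,\ \underline{\dim}_{\mathrm{B}}C\}\ \le\ \underline{\dim}_{\mathrm{B}}F_C\ \le\ \max\{s,\ \overline{\dim}_{\mathrm{B}}C\}.$$
   Context: Let $n=2$. An affine IFS on $\mathbb{R}^n$ is a finite collection $\{S_i\}_{i=1}^N$ of affine maps $S_i(x)=A_ix+b_i$ with $A_i\in \mathrm{GL}(\mathbb{R},n)$, $b_i\in\mathbb{R}^n$, each contracting: there is $c\in(0,1)$ with $|S_i(x)-S_i(y)|\le c|x-y|$ for all $x,y$ (Euclidean norm). For compact $C\subset\mathbb{R}^n$, the inhomogeneous self-affine set $F_C$ with condensation set $C$ is the unique non-empty compact set with $F_C=\bigcup_{i=1}^N S_i(F_C)\cup C$. COSC: there exists an open set $U\subset\mathbb{R}^n$ with $C\subset U\setminus\bigcup_{i=1}^N\overline{S_i(U)}$, $S_i(U)\subset U$ for all $i$, and $S_i(U)\cap S_j(U)=\emptyset$ whenever $i\ne j$. Words: $\mathcal{I}=\{1,\dots,N\}$, and for $\mathbf{i}=(i_1,\dots,i_k)\in\mathcal{I}^k$,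 $S_{\mathbf{i}}=S_{i_1}\circ\cdots\circ S_{i_k}$. Affinity dimension: for $A\in\mathrm{GL}(\mathbb{R},n)$ let $\alpha_1(A)\ge\dots\ge\alpha_n(A)>0$ be its singular values. For $0< t\le n$ put $\phi^t(A)=\alpha_1(A)\cdots\alpha_{m-1}(A)\,\alpha_m(A)^{t-m+1}$, where $m$ is the integer with $m-1<t\le m$; put $\phi^0(A)=1$ and $\phi^t(A)=|\det A|^{t/n}$ for $t>n$. For an affine map $S$ with linear part $A$, $\phi^t(S)=\phi^t(A)$. For $k\in\mathbb{N}$ let $s_k$ be the solution of $\sum_{\mathbf{i}\in\mathcal{I}^k}\phi^{s_k}(S_{\mathbf{i}})=1$. The limit $s=\lim_{k\to\infty}s_k$ exists and is called the affinity dimension of the IFS. Box dimensions: for non-empty bounded $F\subset\mathbb{R}^n$, $N_\delta(F)$ is the minimum number of hypercubes of sidelength $\delta$ needed to cover $F$; $\overline{\dim}_{\mathrm{B}}F$ and $\underline{\dim}_{\mathrm{B}}F$ are respectively the $\limsup$ and $\liminf$ as $\delta\to0$ of $\frac{\log N_\delta(F)}{-\log\delta}$. *)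

theory Defs
  imports "HOL-Analysis.Analysis" "HOL-Computational_Algebra.Polynomial"
begin

section \<open>Singular values and the singular value function\<close>

definition charpoly :: "real ^ 'n ^ 'n \<Rightarrow> real poly" where
  "charpoly M = det (\<chi> i j. (if i = j then [:0, 1:] else 0) - [:M $ i $ j:])"

text \<open>The square roots of the eigenvalues of the symmetric matrix \<open>A\<^sup>T A\<close>, listed in decreasing
  order and with multiplicity; \<open>singular_value\<close> counts them from 1.\<close>

definition singular_values :: "real ^ 'n ^ 'n \<Rightarrow> real list" where
  "singular_values A =
     rev (sorted_list_of_multiset (image_mset sqrt (proots (charpoly (transpose A ** A)))))"

definition singular_value :: "nat \<Rightarrow> real ^ 'n ^ 'n \<Rightarrow> real" where
  "singular_value j A = singular_values A ! (j - 1)"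

text \<open>Only meaningful for \<open>t \<ge> 0\<close>. For \<open>0 < t\<close> the integer \<open>m\<close> with \<open>m - 1 < t \<le> m\<close> is
  the ceiling of \<open>t\<close>.\<close>

definition phi :: "real \<Rightarrow> real ^ 'n ^ 'n \<Rightarrow> real" where
  "phi t A =
     (if t = 0 then 1
      else if t \<le> real CARD('n) then
        (let m = nat \<lceil>t\<rceil> in
           (\<Prod>j = 1..m - 1. singular_value j A) * singular_value m A powr (t - real m + 1))
      else \<bar>det A\<bar> powr (t / real CARD('n)))"

section \<open>Affine iterated function systems\<close>

definition affine_IFS :: "nat \<Rightarrow> (nat \<Rightarrow> real ^ 'n \<Rightarrow> real ^ 'n) \<Rightarrow> bool" where
  "affine_IFS N S \<longleftrightarrow> 1 \<le> N \<and>
     (\<forall>i\<in>{1..N}.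
        (\<exists>A b. invertible A \<and> S i = (\<lambda>x. A *v x + b)) \<and>
        (\<exists>c. 0 < c \<and> c < 1 \<and> (\<forall>x y. norm (S i x - S i y) \<le> c * norm (x - y))))"

definition linear_part :: "(real ^ 'n \<Rightarrow> real ^ 'n) \<Rightarrow> real ^ 'n ^ 'n" where
  "linear_part T = matrix (\<lambda>x. T x - T 0)"

definition words :: "nat \<Rightarrow> nat \<Rightarrow> nat list set" where
  "words N k = {w. set w \<subseteq> {1..N} \<and> length w = k}"

definition word_map :: "(nat \<Rightarrow> 'a \<Rightarrow> 'a) \<Rightarrow> nat list \<Rightarrow> 'a \<Rightarrow> 'a" where
  "word_map S w = foldr (\<lambda>i f. S i \<circ> f) w id"

text \<open>For an affine IFS and \<open>k \<ge> 1\<close> the sum below is continuous and strictly decreasing in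
  \<open>t \<ge> 0\<close>, with value \<open>N ^ k\<close> at 0 and limit 0, so the solution exists and is unique.
  The case \<open>k = 0\<close> is irrelevant for the limit.\<close>

definition affinity_exponent :: "nat \<Rightarrow> (nat \<Rightarrow> real ^ 'n \<Rightarrow> real ^ 'n) \<Rightarrow> nat \<Rightarrow> real" where
  "affinity_exponent N S k =
     (THE t. 0 \<le> t \<and> (\<Sum>w\<in>words N k. phi t (linear_part (word_map S w))) = 1)"

definition affinity_dim :: "nat \<Rightarrow> (nat \<Rightarrow> real ^ 'n \<Rightarrow> real ^ 'n) \<Rightarrow> real" where
  "affinity_dim N S = lim (affinity_exponent N S)"

definition inhomogeneous_set ::
  "nat \<Rightarrow> (nat \<Rightarrow> real ^ 'n \<Rightarrow> real ^ 'n) \<Rightarrow> (real ^ 'n) set \<Rightarrow> (real ^ 'n) set" where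
  "inhomogeneous_set N S C =
     (THE F. F \<noteq> {} \<and> compact F \<and> F = (\<Union>i\<in>{1..N}. S i ` F) \<union> C)"

definition COSC ::
  "nat \<Rightarrow> (nat \<Rightarrow> real ^ 'n \<Rightarrow> real ^ 'n) \<Rightarrow> (real ^ 'n) set \<Rightarrow> bool" where
  "COSC N S C \<longleftrightarrow>
     (\<exists>U. open U \<and>
        C \<subseteq> U - (\<Union>i\<in>{1..N}. closure (S i ` U)) \<and>
        (\<forall>i\<in>{1..N}. S i ` U \<subseteq> U) \<and>
        (\<forall>i\<in>{1..N}. \<forall>j\<in>{1..N}. i \<noteq> j \<longrightarrow> S i ` U \<inter> S j ` U = {}))"

section \<open>Box dimensions\<close>

text \<open>Hypercubes are taken closed and with sides parallel to the coordinate axes.\<close>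

definition covering_number :: "real \<Rightarrow> (real ^ 'n) set \<Rightarrow> nat" where
  "covering_number \<delta> F =
     (LEAST m. \<exists>P. finite P \<and> card P = m \<and> F \<subseteq> (\<Union>a\<in>P. cbox a (a + (\<chi> i. \<delta>))))"

definition upper_box_dim :: "(real ^ 'n) set \<Rightarrow> ereal" where
  "upper_box_dim F =
     Limsup (at_right 0) (\<lambda>\<delta>. ereal (ln (real (covering_number \<delta> F)) / (- ln \<delta>)))"

definition lower_box_dim :: "(real ^ 'n) set \<Rightarrow> ereal" where
  "lower_box_dim F =
     Liminf (at_right 0) (\<lambda>\<delta>. ereal (ln (real (covering_number \<delta> F)) / (- ln \<delta>)))"

end

theory Submission
  imports Defs "HOL-Library.Sublist"
begin

text \<open>In the plane the singular values of an invertible matrix \<open>A\<close> are its operator norm \<open>stretch A\<close>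
and \<open>squeeze A = \<bar>det A\<bar> / stretch A\<close>, the least factor by which \<open>A\<close> scales lengths; for \<open>1 \<le> t \<le> 2\<close> the
singular value function is \<open>stretch A * squeeze A powr (t - 1)\<close>. Only such exponents matter: a
connected component of \<open>C\<close> that lies in no line forces both box dimensions of \<open>C\<close>, and those of \<open>F\<close>, to
be at least 1 (\<open>lower_box_dim_C_ge_1\<close>). The other ingredients that need no dynamics are
\<open>C \<subseteq> F\<close>, monotonicity of the box dimensions, and the bound 2 for the dimension of any bounded set.

The affinity dimension \<open>s\<close> is used through two facts. The sums of \<open>phi t\<close> over words of
length \<open>k\<close> are submultiplicative in \<open>k\<close>, so the exponents \<open>s\<^sub>k\<close> converge to their infimum. Hence for
\<open>t > s\<close> the sum of \<open>phi t\<close> over all words is finite, whereas for \<open>t \<le> s\<close> every finite set of words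
that meets every long word in a prefix has \<open>phi t\<close>-sum at least 1 (\<open>cut_set_sum_ge_1\<close>).

For the upper bound take \<open>t\<close> above \<open>s\<close> and above the upper box dimension of \<open>C\<close>. A point of \<open>F\<close> is
followed down the tree of words until it lies in the image of \<open>C\<close> under a word map or the word
squeezes to about the scale \<open>\<delta>\<close> (\<open>F_decomposition\<close>). Such an image of \<open>C\<close> or of \<open>F\<close> needs at most a
constant times \<open>phi t\<close> of the word times \<open>\<delta> powr (- t)\<close> squares of side \<open>\<delta>\<close>, because a square whose
image has thickness about \<open>\<delta>\<close> is mapped into a strip with thickness comparable to \<open>\<delta>\<close>. Summing over
all words gives \<open>upper_box_dim_F_le\<close>.

For the lower bound let \<open>K\<close> be the component of \<open>C\<close> in no line and let \<open>1 \<le> t \<le> s\<close>. Stop each word as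
soon as it squeezes to the scale \<open>\<delta>\<close>. The image of the connected set \<open>K\<close> has extent at least a
constant times \<open>stretch\<close> of the word in some direction, so it carries about \<open>stretch / \<delta>\<close> points
that are \<open>\<delta>\<close>-separated. By the open set condition, a ball of radius comparable to \<open>\<delta>\<close> about a point
of the image under one stopped word is missed by the images under all others. Thus \<open>F\<close> contains about
\<open>\<delta> powr (- t)\<close> times the \<open>phi t\<close>-sum over stopped words many separated points, and that sum is at
least 1 (\<open>lower_box_dim_F_ge\<close>). If \<open>s < 1\<close>, the bound 1 above already suffices.\<close>

section \<open>Planar linear maps and their singular values\<close>

definition stretch :: "real ^ 2 ^ 2 \<Rightarrow> real" where
  "stretch A = onorm ((*v) A)"

definition squeeze :: "real ^ 2 ^ 2 \<Rightarrow> real" where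
  "squeeze A = \<bar>det A\<bar> / stretch A"

text \<open>Rotation by a right angle. In the plane it replaces the orthogonal complement of a vector and
turns determinants into inner products.\<close>

definition perp :: "real ^ 2 \<Rightarrow> real ^ 2" where
  "perp x = vector [- x $ 2, x $ 1]"

lemma inner_2: "x \<bullet> y = x $ 1 * y $ 1 + x $ 2 * y $ 2" for x y :: "real ^ 2"
  by (simp add: inner_vec_def sum_2)

lemma mult_vec_2: "(A *v x) $ i = A $ i $ 1 * x $ 1 + A $ i $ 2 * x $ 2" for A :: "real ^ 2 ^ 2"
  by (simp add: matrix_vector_mult_def sum_2)

lemma perp_nth [simp]: "perp x $ 1 = - x $ 2" "perp x $ 2 = x $ 1"
  by (simp_all add: perp_def)

lemma norm_perp [simp]: "norm (perp x) = norm x"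
  by (simp add: norm_eq_sqrt_inner inner_2)

lemma perp_inner [simp]: "x \<bullet> perp x = 0" "perp x \<bullet> x = 0"
  by (simp_all add: inner_2)

lemma perp_decomposition_general:
  "(u \<bullet> u) *\<^sub>R y = (y \<bullet> u) *\<^sub>R u + (y \<bullet> perp u) *\<^sub>R perp u"
  by (simp add: vec_eq_iff forall_2 inner_2 algebra_simps)

lemma perp_decomposition:
  "norm e = 1 \<Longrightarrow> y = (y \<bullet> e) *\<^sub>R e + (y \<bullet> perp e) *\<^sub>R perp e"
  using perp_decomposition_general[of e y] by (simp add: norm_eq_1)

lemma det_perp: "perp (A *v x) \<bullet> (A *v y) = det A * (perp x \<bullet> y)"
  by (simp add: inner_2 det_2 mult_vec_2 algebra_simps)

lemma norm_mult_vec_le: "norm (A *v x) \<le> stretch A * norm x"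
  unfolding stretch_def by (rule onorm) (rule matrix_vector_mul_bounded_linear)

lemma stretch_le: "(\<And>x. norm (A *v x) \<le> b * norm x) \<Longrightarrow> stretch A \<le> b"
  unfolding stretch_def by (rule onorm_le)

lemma stretch_nonneg: "0 \<le> stretch A"
  unfolding stretch_def by (rule onorm_pos_le) (rule matrix_vector_mul_bounded_linear)

text \<open>A continuous function on the compact unit circle attains its maximum. A direction of maximal
stretching plays the part of the first right singular vector.\<close>

lemma stretch_attained:
  obtains u where "norm u = 1" "norm (A *v u) = stretch A"
proof -
  have "compact (sphere (0 :: real ^ 2) 1)" by simp
  moreover have "(axis 1 1 :: real ^ 2) \<in> sphere 0 1" by (simp add: norm_axis_1)
  moreover have "continuous_on (sphere 0 1) (\<lambda>x. norm (A *v x))"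
    by (intro continuous_intros)
  ultimately obtain u where u: "u \<in> sphere 0 1"
    and max: "\<And>x. x \<in> sphere 0 1 \<Longrightarrow> norm (A *v x) \<le> norm (A *v u)"
    by (metis (no_types, lifting) continuous_attains_sup empty_iff)
  have "norm (A *v x) \<le> norm (A *v u) * norm x" for x
  proof (cases "x = 0")
    case False
    have "norm (A *v ((1 / norm x) *\<^sub>R x)) \<le> norm (A *v u)"
      using False by (intro max) simp
    then show ?thesis
      using False by (simp add: scaleR_matrix_vector_assoc[symmetric] matrix_vector_mult_scaleR divide_simps)
  qed simp
  then have "stretch A \<le> norm (A *v u)" by (rule stretch_le)
  moreover have "norm (A *v u) \<le> stretch A" using norm_mult_vec_le[of A u] u by simp
  ultimately show thesis using u that by force
qed

lemma stretch_pos: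
  assumes "invertible A" shows "0 < stretch A"
proof (rule ccontr)
  assume "\<not> 0 < stretch A"
  then have "norm (A *v axis 1 1) \<le> 0"
    using norm_mult_vec_le[of A "axis 1 1"] unfolding norm_axis_1 by linarith
  then have "A *v axis 1 1 = A *v 0" by simp
  then have "axis 1 1 = (0 :: real ^ 2)"
    using inj_matrix_vector_mult[OF assms] by (meson injD)
  then show False by simp
qed

lemma squeeze_pos: "invertible A \<Longrightarrow> 0 < squeeze A"
  unfolding squeeze_def using stretch_pos[of A] by (simp add: invertible_det_nz)

lemma stretch_squeeze: "invertible A \<Longrightarrow> stretch A * squeeze A = \<bar>det A\<bar>"
  unfolding squeeze_def using stretch_pos[of A] by simp

text \<open>The vectors \<open>x\<close> and \<open>perp x\<close> span a square, whose image has area \<open>\<bar>det A\<bar> * (norm x)\<^sup>2\<close>. That area is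
at most the product of the two image lengths, of which the second is at most \<open>stretch A * norm x\<close>.\<close>

lemma squeeze_norm_le:
  assumes "invertible A"
  shows "squeeze A * norm x \<le> norm (A *v x)"
proof (cases "x = 0")
  case False
  have "\<bar>det A\<bar> * (norm x * norm x) = \<bar>perp (A *v x) \<bullet> (A *v perp x)\<bar>"
    by (simp add: det_perp abs_mult dot_square_norm power2_eq_square)
  also have "\<dots> \<le> norm (A *v x) * norm (A *v perp x)"
    using Cauchy_Schwarz_ineq2[of "perp (A *v x)" "A *v perp x"] by simp
  also have "\<dots> \<le> norm (A *v x) * (stretch A * norm x)"
    using norm_mult_vec_le[of A "perp x"] by (intro mult_left_mono) auto
  finally have "\<bar>det A\<bar> * norm x \<le> norm (A *v x) * stretch A"
    using False by (simp add: mult.assoc flip: mult.assoc)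
  then show ?thesis
    using stretch_pos[OF assms] by (simp add: squeeze_def divide_simps)
qed simp

lemma stretch_mat_1 [simp]: "stretch (mat 1) = 1"
proof (rule antisym)
  show "stretch (mat 1) \<le> 1" by (rule stretch_le) simp
  show "1 \<le> stretch (mat 1)" using norm_mult_vec_le[of "mat 1" "axis 1 1"] by (simp add: norm_axis_1)
qed

lemma squeeze_mat_1 [simp]: "squeeze (mat 1) = 1"
  by (simp add: squeeze_def)

lemma squeeze_le_stretch: "invertible A \<Longrightarrow> squeeze A \<le> stretch A"
  using squeeze_norm_le[of A "axis 1 1"] norm_mult_vec_le[of A "axis 1 1"] by (simp add: norm_axis_1)

lemma stretch_mult_le: "stretch (A ** B) \<le> stretch A * stretch B"
proof (rule stretch_le)
  fix x
  have "norm ((A ** B) *v x) \<le> stretch A * norm (B *v x)"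
    using norm_mult_vec_le[of A "B *v x"] by (simp add: matrix_vector_mul_assoc)
  also have "\<dots> \<le> stretch A * (stretch B * norm x)"
    by (intro mult_left_mono norm_mult_vec_le stretch_nonneg)
  finally show "norm ((A ** B) *v x) \<le> stretch A * stretch B * norm x" by (simp add: mult.assoc)
qed

lemma squeeze_mult_ge:
  assumes "invertible A" "invertible B"
  shows "squeeze A * squeeze B \<le> squeeze (A ** B)"
proof -
  have "stretch (A ** B) > 0" using assms by (simp add: invertible_mult stretch_pos)
  then show ?thesis
    using stretch_mult_le[of A B] stretch_pos assms
    by (simp add: squeeze_def det_mul abs_mult frac_le)
qed

text \<open>Substituting \<open>B\<inverse>\<close> in the submultiplicativity of \<open>stretch\<close> gives
\<open>stretch A * squeeze B \<le> stretch (A ** B)\<close>, and \<open>det\<close> is multiplicative. Along prefixes of words of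
contractions this makes \<open>squeeze\<close> decreasing.\<close>

lemma squeeze_mult_le:
  assumes "invertible A" "invertible B"
  shows "squeeze (A ** B) \<le> squeeze A * stretch B"
proof -
  have AB: "invertible (A ** B)" using assms by (rule invertible_mult)
  obtain u where u: "norm u = 1" "norm (A *v u) = stretch A" by (rule stretch_attained)
  obtain v where v: "u = B *v v"
    using assms(2) by (metis invertible_def matrix_vector_mul_assoc matrix_vector_mul_lid)
  have "stretch A \<le> stretch (A ** B) * norm v"
    using norm_mult_vec_le[of "A ** B" v] u v by (simp add: matrix_vector_mul_assoc)
  moreover have "squeeze B * norm v \<le> 1" using squeeze_norm_le[OF assms(2), of v] u v by simp
  ultimately have "stretch A * squeeze B \<le> stretch (A ** B)"
    using squeeze_pos[OF assms(2)] stretch_pos[OF AB]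
    by (smt (verit, best) mult.commute mult.left_commute mult_left_le mult_right_mono)
  then have "stretch A * squeeze B * stretch B \<le> stretch (A ** B) * stretch B"
    using stretch_nonneg by (rule mult_right_mono)
  then have "\<bar>det A\<bar> * (stretch A * (stretch B * squeeze B)) \<le> \<bar>det A\<bar> * (stretch (A ** B) * stretch B)"
    by (intro mult_left_mono) (simp_all add: mult_ac)
  then show ?thesis
    using stretch_pos[OF AB] stretch_pos[OF assms(1)] unfolding stretch_squeeze[OF assms(2)]
    by (simp add: squeeze_def det_mul abs_mult divide_simps mult_ac)
qed

text \<open>With \<open>u\<close> a unit vector of maximal stretching, the direction \<open>e\<close> of \<open>A *v u\<close> is the long axis of the
ellipse onto which \<open>A\<close> maps the unit disc. The thickness orthogonal to \<open>e\<close> comes from the area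
identity \<open>det_perp\<close>. The last property says that a set of width \<open>L\<close> in every direction has an image of
extent at least \<open>L * stretch A\<close> along \<open>e\<close>.\<close>

lemma matrix_image_in_strip:
  assumes "invertible A"
  obtains e where "norm e = 1"
    and "\<And>z. \<bar>(A *v z) \<bullet> e\<bar> \<le> stretch A * norm z"
    and "\<And>z. \<bar>(A *v z) \<bullet> perp e\<bar> \<le> squeeze A * norm z"
    and "stretch A \<le> norm (transpose A *v e)"
proof -
  obtain u where u: "norm u = 1" "norm (A *v u) = stretch A" by (rule stretch_attained)
  define e where "e = (1 / stretch A) *\<^sub>R (A *v u)"
  note pos = stretch_pos[OF assms]
  have e1: "norm e = 1" using pos u by (simp add: e_def)
  show thesis
  proof
    show "norm e = 1" by fact
    show "\<bar>(A *v z) \<bullet> e\<bar> \<le> stretch A * norm z" for z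
      using Cauchy_Schwarz_ineq2[of "A *v z" e] norm_mult_vec_le[of A z] e1 by simp
    show "\<bar>(A *v z) \<bullet> perp e\<bar> \<le> squeeze A * norm z" for z
    proof -
      have "perp e = (1 / stretch A) *\<^sub>R perp (A *v u)"
        by (simp add: e_def vec_eq_iff forall_2)
      then have "(A *v z) \<bullet> perp e = det A * (perp u \<bullet> z) / stretch A"
        by (simp add: inner_commute[of "A *v z"] det_perp)
      moreover have "\<bar>perp u \<bullet> z\<bar> \<le> norm z"
        using Cauchy_Schwarz_ineq2[of "perp u" z] u by simp
      ultimately show ?thesis
        using pos by (simp add: squeeze_def abs_mult divide_right_mono mult_left_mono)
    qed
    have "stretch A = (A *v u) \<bullet> e"
      using u pos by (simp add: e_def dot_square_norm power2_eq_square)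
    also have "\<dots> = u \<bullet> (transpose A *v e)"
      by (simp add: inner_2 mult_vec_2 transpose_def algebra_simps)
    also have "\<dots> \<le> norm (transpose A *v e)"
      using norm_cauchy_schwarz[of u "transpose A *v e"] u by simp
    finally show "stretch A \<le> norm (transpose A *v e)" .
  qed
qed

lemma linear_le_square_imp_zero:
  fixes c d :: real
  assumes "\<And>t. c * t \<le> d * t\<^sup>2"
  shows "c = 0"
proof (rule ccontr)
  assume c: "c \<noteq> 0"
  \<comment> \<open>For small \<open>t\<close> with the sign of \<open>c\<close> the linear term dominates.\<close>
  define t where "t = c / (2 * (\<bar>d\<bar> + 1))"
  have "c * t \<le> d * t\<^sup>2" by (rule assms)
  also have "\<dots> \<le> (\<bar>d\<bar> + 1) * t\<^sup>2" by (intro mult_right_mono) auto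
  also have "\<dots> = t * ((\<bar>d\<bar> + 1) * t)" by (simp add: power2_eq_square)
  also have "(\<bar>d\<bar> + 1) * t = c / 2"
    using abs_ge_zero[of d] by (simp add: t_def field_simps)
  finally have "c * t \<le> 0" by (simp add: mult.commute)
  moreover have "c * t > 0" using c by (simp add: t_def zero_less_mult_iff zero_less_divide_iff) auto
  ultimately show False by simp
qed

text \<open>Both sides are the trace of \<open>A\<^sup>T A\<close>. If \<open>u\<close> is a unit vector of maximal stretching, then the images of
\<open>u\<close> and \<open>perp u\<close> are orthogonal by a first-order variation, so the area identity gives the length of
the second one as \<open>squeeze A\<close>; the sum of the squared lengths does not depend on the orthonormal
basis.\<close>

lemma stretch_squeeze_sum_squares:
  fixes A :: "real ^ 2 ^ 2"
  assumes "invertible A"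
  shows "(stretch A)\<^sup>2 + (squeeze A)\<^sup>2 =
    (A $ 1 $ 1)\<^sup>2 + (A $ 1 $ 2)\<^sup>2 + (A $ 2 $ 1)\<^sup>2 + (A $ 2 $ 2)\<^sup>2"
proof -
  obtain u where u: "norm u = 1" "norm (A *v u) = stretch A" by (rule stretch_attained)
  have ortho: "(A *v u) \<bullet> (A *v perp u) = 0"
  proof -
    have "2 * ((A *v u) \<bullet> (A *v perp u)) * t \<le> ((stretch A)\<^sup>2 - (norm (A *v perp u))\<^sup>2) * t\<^sup>2" for t
    proof -
      have "(norm (A *v (u + t *\<^sub>R perp u)))\<^sup>2 \<le> (stretch A * norm (u + t *\<^sub>R perp u))\<^sup>2"
        by (intro power_mono norm_mult_vec_le) simp
      moreover have "(norm (u + t *\<^sub>R perp u))\<^sup>2 = 1 + t\<^sup>2"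
        using u by (simp add: power2_norm_eq_inner inner_simps norm_eq_1) (simp add: dot_square_norm u power2_eq_square)
      moreover have "(norm (A *v (u + t *\<^sub>R perp u)))\<^sup>2 =
        (stretch A)\<^sup>2 + 2 * ((A *v u) \<bullet> (A *v perp u)) * t + t\<^sup>2 * (norm (A *v perp u))\<^sup>2"
        unfolding u(2)[symmetric]
        unfolding power2_norm_eq_inner matrix_vector_right_distrib matrix_vector_mult_scaleR
        by (simp add: inner_2 power2_eq_square algebra_simps)
      ultimately show ?thesis by (simp add: power_mult_distrib algebra_simps)
    qed
    from linear_le_square_imp_zero[OF this] show ?thesis by simp
  qed
  have "(perp (A *v u) \<bullet> (A *v perp u))\<^sup>2 + ((A *v u) \<bullet> (A *v perp u))\<^sup>2 =
    (norm (A *v u))\<^sup>2 * (norm (A *v perp u))\<^sup>2"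
    unfolding power2_norm_eq_inner by (simp add: inner_2 power2_eq_square algebra_simps)
  then have "(det A)\<^sup>2 = (stretch A)\<^sup>2 * (norm (A *v perp u))\<^sup>2"
    using u by (simp add: ortho det_perp dot_square_norm)
  then have "(squeeze A)\<^sup>2 = (norm (A *v perp u))\<^sup>2"
    using stretch_pos[OF assms] by (simp add: squeeze_def power_divide)
  then have "(stretch A)\<^sup>2 + (squeeze A)\<^sup>2 = (norm (A *v u))\<^sup>2 + (norm (A *v perp u))\<^sup>2"
    using u by simp
  also have "\<dots> = ((A $ 1 $ 1)\<^sup>2 + (A $ 1 $ 2)\<^sup>2 + (A $ 2 $ 1)\<^sup>2 + (A $ 2 $ 2)\<^sup>2) * (u \<bullet> u)"
    unfolding power2_norm_eq_inner by (simp add: inner_2 mult_vec_2 power2_eq_square algebra_simps)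
  finally show ?thesis using u by (simp add: norm_eq_1)
qed

text \<open>The squares of \<open>stretch A\<close> and \<open>squeeze A\<close> have sum the trace and product the determinant of
\<open>A\<^sup>T A\<close>, hence they are the roots of its characteristic polynomial.\<close>

lemma singular_values_2:
  fixes A :: "real ^ 2 ^ 2"
  assumes "invertible A"
  shows "singular_values A = [stretch A, squeeze A]"
proof -
  have "charpoly (transpose A ** A) = [:- (stretch A)\<^sup>2, 1:] * [:- (squeeze A)\<^sup>2, 1:]"
  proof -
    have "(stretch A)\<^sup>2 * (squeeze A)\<^sup>2 = (det A)\<^sup>2"
      using stretch_squeeze[OF assms] by (metis power2_abs power_mult_distrib)
    then show ?thesis
      using stretch_squeeze_sum_squares[OF assms]
      by (simp add: charpoly_def det_2 matrix_matrix_mult_def transpose_def sum_2 power2_eq_square algebra_simps)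
  qed
  then have "proots (charpoly (transpose A ** A)) = {#(stretch A)\<^sup>2#} + {#(squeeze A)\<^sup>2#}"
    by (simp add: proots_mult del: mult_pCons_left mult_pCons_right)
  then have "image_mset sqrt (proots (charpoly (transpose A ** A))) = {#stretch A, squeeze A#}"
    using stretch_nonneg squeeze_pos[OF assms] by simp
  then show ?thesis
    using squeeze_le_stretch[OF assms] by (simp add: singular_values_def)
qed

section \<open>The planar singular value function\<close>

text \<open>Together with \<open>squeeze_weight\<close>, the exponents of the two singular values in \<open>phi t\<close>, written so that
one formula covers the ranges \<open>[0, 1]\<close>, \<open>[1, 2]\<close> and \<open>[2, \<infinity>)\<close>. They add up to \<open>t\<close>.\<close>

definition stretch_weight :: "real \<Rightarrow> real" where
  "stretch_weight t = max (min t 1) (t / 2)"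

definition squeeze_weight :: "real \<Rightarrow> real" where
  "squeeze_weight t = max 0 (min (t - 1) (t / 2))"

lemma weights_sum: "0 \<le> t \<Longrightarrow> stretch_weight t + squeeze_weight t = t"
  by (auto simp: stretch_weight_def squeeze_weight_def max_def min_def field_simps)

lemma weights_mono:
  "t \<le> t' \<Longrightarrow> stretch_weight t \<le> stretch_weight t'" "t \<le> t' \<Longrightarrow> squeeze_weight t \<le> squeeze_weight t'"
  by (auto simp: stretch_weight_def squeeze_weight_def max_def min_def field_simps)

lemma weights_le: "0 \<le> t \<Longrightarrow> squeeze_weight t \<le> stretch_weight t" "0 \<le> squeeze_weight t"
  by (auto simp: stretch_weight_def squeeze_weight_def max_def min_def field_simps)

lemma phi_eq:
  fixes A :: "real ^ 2 ^ 2"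
  assumes A: "invertible A" and t: "0 \<le> t"
  shows "phi t A = stretch A powr stretch_weight t * squeeze A powr squeeze_weight t"
proof -
  note pos = stretch_pos[OF A] squeeze_pos[OF A]
  consider "t = 0" | "0 < t" "t \<le> 1" | "1 < t" "t \<le> 2" | "2 < t" using t by linarith
  then show ?thesis
  proof cases
    case 1
    then show ?thesis
      using pos by (simp add: phi_def stretch_weight_def squeeze_weight_def)
  next
    case 2
    then have "\<lceil>t\<rceil> = 1" by (simp add: ceiling_eq_iff)
    then show ?thesis
      using 2 pos by (simp add: phi_def stretch_weight_def squeeze_weight_def singular_value_def
          singular_values_2[OF A] max_def min_def)
  next
    case 3
    then have "\<lceil>t\<rceil> = 2" by (simp add: ceiling_eq_iff)
    then show ?thesis
      using 3 pos by (simp add: phi_def stretch_weight_def squeeze_weight_def singular_value_def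
          singular_values_2[OF A] max_def min_def)
  next
    case 4
    then show ?thesis
      using pos by (simp add: phi_def stretch_weight_def squeeze_weight_def
          max_def min_def powr_mult flip: stretch_squeeze[OF A])
  qed
qed

lemma phi_pos: "invertible A \<Longrightarrow> 0 \<le> t \<Longrightarrow> 0 < phi t A" for A :: "real ^ 2 ^ 2"
  using stretch_pos[of A] squeeze_pos[of A] by (simp add: phi_eq)

text \<open>Rewriting \<open>phi t\<close> as a nonnegative power of \<open>stretch\<close> times a nonnegative power of \<open>\<bar>det\<bar>\<close>
reduces the claim to submultiplicativity of the norm and multiplicativity of the determinant.\<close>

lemma phi_mult_le:
  fixes A B :: "real ^ 2 ^ 2"
  assumes A: "invertible A" and B: "invertible B" and t: "0 \<le> t"
  shows "phi t (A ** B) \<le> phi t A * phi t B"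
proof -
  have phi: "phi t M = stretch M powr (stretch_weight t - squeeze_weight t) * \<bar>det M\<bar> powr squeeze_weight t"
    if "invertible M" for M :: "real ^ 2 ^ 2"
    using stretch_pos[OF that] squeeze_pos[OF that]
    by (simp add: phi_eq[OF that t] powr_mult flip: stretch_squeeze[OF that])
       (simp flip: powr_add mult.assoc)
  have "phi t (A ** B) \<le> (stretch A * stretch B) powr (stretch_weight t - squeeze_weight t) *
      \<bar>det (A ** B)\<bar> powr squeeze_weight t"
    unfolding phi[OF invertible_mult[OF A B]]
    using weights_le(1)[OF t] weights_le(2)[of t] stretch_mult_le[of A B] stretch_nonneg
    by (intro mult_right_mono powr_mono2) auto
  also have "\<dots> = phi t A * phi t B"
    unfolding phi[OF A] phi[OF B] by (simp add: powr_mult stretch_nonneg det_mul abs_mult)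
  finally show ?thesis .
qed

text \<open>Both weights increase with \<open>t\<close>, by \<open>t' - t\<close> in total, and both singular values are at most \<open>c\<close>.\<close>

lemma phi_decrease:
  fixes A :: "real ^ 2 ^ 2"
  assumes A: "invertible A" and c: "stretch A \<le> c" and t: "0 \<le> t" "t \<le> t'"
  shows "phi t' A \<le> c powr (t' - t) * phi t A"
proof -
  note pos = stretch_pos[OF A] squeeze_pos[OF A]
  have le: "squeeze A \<le> c" using c squeeze_le_stretch[OF A] by simp
  have split: "x powr w' = x powr (w' - w) * x powr w" for x w w' :: real
    by (simp flip: powr_add)
  have "phi t' A = (stretch A powr (stretch_weight t' - stretch_weight t) *
      squeeze A powr (squeeze_weight t' - squeeze_weight t)) * phi t A"
    using t by (simp add: phi_eq[OF A] split[of "stretch A" "stretch_weight t'" "stretch_weight t"]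
        split[of "squeeze A" "squeeze_weight t'" "squeeze_weight t"])
  also have "\<dots> \<le> (c powr (stretch_weight t' - stretch_weight t) *
      c powr (squeeze_weight t' - squeeze_weight t)) * phi t A"
    using c le pos weights_mono[OF t(2)] phi_pos[OF A t(1)]
    by (intro mult_right_mono mult_mono powr_mono2) auto
  also have "\<dots> = c powr (t' - t) * phi t A"
    proof -
    have "stretch_weight t' - stretch_weight t + (squeeze_weight t' - squeeze_weight t) = t' - t"
      using weights_sum[of t] weights_sum[of t'] t by simp
    then show ?thesis by (simp flip: powr_add)
  qed
  finally show ?thesis .
qed

lemma continuous_on_phi:
  fixes A :: "real ^ 2 ^ 2"
  assumes "invertible A"
  shows "continuous_on {0..} (\<lambda>t. phi t A)"
proof -
  have "continuous_on {0..} (\<lambda>t. stretch A powr stretch_weight t * squeeze A powr squeeze_weight t)"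
    unfolding stretch_weight_def squeeze_weight_def
    using stretch_pos[OF assms] squeeze_pos[OF assms] by (intro continuous_intros) auto
  then show ?thesis by (rule continuous_on_eq) (simp add: phi_eq[OF assms])
qed

lemma phi_between_1_2:
  fixes A :: "real ^ 2 ^ 2"
  assumes "invertible A" "1 \<le> t" "t \<le> 2"
  shows "phi t A = stretch A * squeeze A powr (t - 1)"
  using assms stretch_pos[of A] by (simp add: phi_eq stretch_weight_def squeeze_weight_def max_def min_def)

section \<open>Coverings by squares\<close>

text \<open>A real bound on the number of squares lets bounds be added and scaled directly; unlike
\<open>covering_number\<close>, it also records that a finite cover exists.\<close>

definition coverable :: "real \<Rightarrow> (real ^ 2) set \<Rightarrow> real \<Rightarrow> bool" where
  "coverable \<delta> E m \<longleftrightarrow>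
     (\<exists>P. finite P \<and> real (card P) \<le> m \<and> E \<subseteq> (\<Union>a\<in>P. cbox a (a + (\<chi> i. \<delta>))))"

lemma covering_number_le:
  assumes "coverable \<delta> E m"
  shows "real (covering_number \<delta> E) \<le> m"
proof -
  obtain P where P: "finite P" "real (card P) \<le> m" "E \<subseteq> (\<Union>a\<in>P. cbox a (a + (\<chi> i. \<delta>)))"
    using assms by (auto simp: coverable_def)
  have "covering_number \<delta> E \<le> card P"
    unfolding covering_number_def using P by (intro Least_le) auto
  then show ?thesis using P by linarith
qed

lemma coverable_covering_number:
  assumes "coverable \<delta> E m"
  shows "coverable \<delta> E (real (covering_number \<delta> E))"
proof -
  obtain P where P: "finite P" "E \<subseteq> (\<Union>a\<in>P. cbox a (a + (\<chi> i. \<delta>)))"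
    using assms by (auto simp: coverable_def)
  have "\<exists>P. finite P \<and> card P = covering_number \<delta> E \<and> E \<subseteq> (\<Union>a\<in>P. cbox a (a + (\<chi> i. \<delta>)))"
    unfolding covering_number_def by (rule LeastI_ex) (use P in blast)
  then show ?thesis by (force simp: coverable_def)
qed

lemma coverable_subset: "coverable \<delta> E m \<Longrightarrow> E' \<subseteq> E \<Longrightarrow> m \<le> m' \<Longrightarrow> coverable \<delta> E' m'"
  unfolding coverable_def by (meson order_trans)

lemma coverable_UN:
  assumes "finite W" "\<And>w. w \<in> W \<Longrightarrow> coverable \<delta> (E w) (m w)"
  shows "coverable \<delta> (\<Union>w\<in>W. E w) (\<Sum>w\<in>W. m w)"
proof -
  have "\<forall>w\<in>W. \<exists>P. finite P \<and> real (card P) \<le> m w \<and> E w \<subseteq> (\<Union>a\<in>P. cbox a (a + (\<chi> i. \<delta>)))"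
    using assms(2) by (simp add: coverable_def)
  from bchoice[OF this] obtain P where P: "\<And>w. w \<in> W \<Longrightarrow> finite (P w)" "\<And>w. w \<in> W \<Longrightarrow> real (card (P w)) \<le> m w"
      "\<And>w. w \<in> W \<Longrightarrow> E w \<subseteq> (\<Union>a\<in>P w. cbox a (a + (\<chi> i. \<delta>)))"
    by blast
  have "real (card (\<Union>w\<in>W. P w)) \<le> (\<Sum>w\<in>W. real (card (P w)))"
    using card_UN_le[OF assms(1), of P] by (simp flip: of_nat_sum)
  also have "\<dots> \<le> (\<Sum>w\<in>W. m w)" using P(2) by (rule sum_mono)
  finally have "real (card (\<Union>w\<in>W. P w)) \<le> (\<Sum>w\<in>W. m w)" .
  moreover have "(\<Union>w\<in>W. E w) \<subseteq> (\<Union>a\<in>(\<Union>w\<in>W. P w). cbox a (a + (\<chi> i. \<delta>)))"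
    unfolding UN_UN_flatten using P(3) by (rule UN_mono[OF order_refl])
  moreover have "finite (\<Union>w\<in>W. P w)" using P(1) assms(1) by simp
  ultimately show ?thesis unfolding coverable_def by (intro exI conjI)
qed

lemma coverable_cball:
  assumes "0 < \<delta>" "0 < n"
  shows "coverable \<delta> (cball y (real n * \<delta>)) (4 * (real n)\<^sup>2)"
proof -
  define I where "I = {- int n..int n - 1}"
  define P where "P = (\<lambda>(i, j). y + vector [real_of_int i * \<delta>, real_of_int j * \<delta>] :: real ^ 2) ` (I \<times> I)"
  have "card P \<le> card (I \<times> I)" unfolding P_def by (rule card_image_le) (simp add: I_def)
  also have "card (I \<times> I) = (2 * n) * (2 * n)"
    by (simp add: I_def card_cartesian_product nat_mult_distrib)
  finally have "real (card P) \<le> real ((2 * n) * (2 * n))" by (rule of_nat_mono)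
  then have card: "real (card P) \<le> 4 * (real n)\<^sup>2" by (simp add: power2_eq_square)
  have "x \<in> (\<Union>a\<in>P. cbox a (a + (\<chi> i. \<delta>)))" if x: "x \<in> cball y (real n * \<delta>)" for x
  proof -
    have cell: "\<exists>i\<in>I. real_of_int i * \<delta> \<le> x $ k - y $ k \<and> x $ k - y $ k \<le> real_of_int i * \<delta> + \<delta>" for k
    proof -
      have "\<bar>x $ k - y $ k\<bar> \<le> real n * \<delta>"
        using x component_le_norm_cart[of "x - y" k] by (simp add: dist_norm norm_minus_commute)
      then have b: "\<bar>(x $ k - y $ k) / \<delta>\<bar> \<le> real n" using assms by (simp add: divide_simps)
      show ?thesis
      proof (cases "(x $ k - y $ k) / \<delta> = real n")
        case True
        then have "x $ k - y $ k = real n * \<delta>" using assms by (simp add: field_simps)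
        then show ?thesis using assms
          by (intro bexI[of _ "int n - 1"]) (auto simp: I_def algebra_simps)
      next
        case False
        define i where "i = \<lfloor>(x $ k - y $ k) / \<delta>\<rfloor>"
        have i: "real_of_int i \<le> (x $ k - y $ k) / \<delta>" "(x $ k - y $ k) / \<delta> < real_of_int i + 1"
          by (simp_all add: i_def)
        have "i \<in> I" proof -
          have "- real n < real_of_int i + 1" "real_of_int i < real n" using i b False by linarith+
          then show ?thesis unfolding I_def by simp
        qed
        then show ?thesis using i assms by (intro bexI[of _ i]) (auto simp: field_simps)
      qed
    qed
    obtain i j where ij: "i \<in> I" "j \<in> I"
      and "real_of_int i * \<delta> \<le> x $ 1 - y $ 1" "x $ 1 - y $ 1 \<le> real_of_int i * \<delta> + \<delta>"
      and "real_of_int j * \<delta> \<le> x $ 2 - y $ 2" "x $ 2 - y $ 2 \<le> real_of_int j * \<delta> + \<delta>"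
      using cell[of 1] cell[of 2] by blast
    then have "x \<in> cbox (y + vector [real_of_int i * \<delta>, real_of_int j * \<delta>])
      (y + vector [real_of_int i * \<delta>, real_of_int j * \<delta>] + (\<chi> i. \<delta>))"
      by (simp add: mem_box_cart forall_2)
    moreover have "y + vector [real_of_int i * \<delta>, real_of_int j * \<delta>] \<in> P"
      using ij unfolding P_def by (intro image_eqI[of _ _ "(i, j)"]) auto
    ultimately show ?thesis by blast
  qed
  moreover have "finite P" by (simp add: P_def I_def)
  ultimately show ?thesis using card unfolding coverable_def by blast
qed

lemma coverable_bounded:
  assumes "bounded E"
  obtains K where "0 < K" "\<And>\<delta>. 0 < \<delta> \<Longrightarrow> \<delta> \<le> 1 \<Longrightarrow> coverable \<delta> E (K / \<delta>\<^sup>2)"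
proof -
  obtain y r where r: "0 < r" "E \<subseteq> cball y r"
    using bounded_subset_ballD[OF assms] ball_subset_cball by (metis order_trans)
  have "coverable \<delta> E (4 * (r + 1)\<^sup>2 / \<delta>\<^sup>2)" if "0 < \<delta>" "\<delta> \<le> 1" for \<delta>
  proof -
    define n where "n = nat \<lceil>r / \<delta>\<rceil>"
    have "r / \<delta> > 0" using r that by simp
    then have n: "0 < n" "r / \<delta> \<le> real n" "real n \<le> r / \<delta> + 1"
      unfolding n_def by linarith+
    then have "r \<le> real n * \<delta>" using that by (simp add: divide_simps)
    then have "E \<subseteq> cball y (real n * \<delta>)" using r by force
    moreover have "4 * (real n)\<^sup>2 \<le> 4 * (r + 1)\<^sup>2 / \<delta>\<^sup>2"
    proof -
      have "1 \<le> 1 / \<delta>" using that by simp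
      then have "real n \<le> (r + 1) / \<delta>" using n by (simp add: add_divide_distrib)
      then have "(real n)\<^sup>2 \<le> ((r + 1) / \<delta>)\<^sup>2" by (intro power_mono) auto
      then show ?thesis by (simp add: power_divide)
    qed
    ultimately show ?thesis
      using coverable_cball[OF that(1) n(1)] by (rule coverable_subset[rotated])
  qed
  then show thesis using that[of "4 * (r + 1)\<^sup>2"] r by simp
qed

lemma covering_number_pos:
  fixes E :: "(real ^ 2) set"
  assumes "bounded E" "E \<noteq> {}" "0 < \<delta>" "\<delta> \<le> 1"
  shows "1 \<le> covering_number \<delta> E"
proof -
  obtain K where "coverable \<delta> E (K / \<delta>\<^sup>2)" using coverable_bounded[OF assms(1)] assms by metis
  then have "coverable \<delta> E (real (covering_number \<delta> E))" by (rule coverable_covering_number)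
  then obtain P where P: "finite P" "card P \<le> covering_number \<delta> E" "E \<subseteq> (\<Union>a\<in>P. cbox a (a + (\<chi> i. \<delta>)))"
    by (auto simp: coverable_def)
  then have "P \<noteq> {}" using assms by auto
  then have "1 \<le> card P" using P(1) by (simp add: Suc_le_eq card_gt_0_iff)
  then show ?thesis using P(2) by simp
qed

lemma covering_number_mono:
  fixes E :: "(real ^ 2) set"
  assumes "bounded E" "E' \<subseteq> E" "0 < \<delta>" "\<delta> \<le> 1"
  shows "covering_number \<delta> E' \<le> covering_number \<delta> E"
proof -
  obtain K where "coverable \<delta> E (K / \<delta>\<^sup>2)" using coverable_bounded[OF assms(1)] assms by metis
  then have "coverable \<delta> E' (real (covering_number \<delta> E))"
    using coverable_covering_number coverable_subset assms(2) by blast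
  then show ?thesis using covering_number_le by fastforce
qed

text \<open>A square of side \<open>\<delta>\<close> has diameter \<open>sqrt 2 * \<delta> < 2 * \<delta>\<close>, so it contains at most one of the points.\<close>

lemma card_separated_le_covering_number:
  fixes E :: "(real ^ 2) set"
  assumes "bounded E" "0 < \<delta>" "\<delta> \<le> 1" "X \<subseteq> E"
    and sep: "\<And>x y. x \<in> X \<Longrightarrow> y \<in> X \<Longrightarrow> x \<noteq> y \<Longrightarrow> 2 * \<delta> \<le> dist x y"
  shows "card X \<le> covering_number \<delta> E"
proof -
  obtain K where "coverable \<delta> E (K / \<delta>\<^sup>2)" using coverable_bounded[OF assms(1)] assms by metis
  then have "coverable \<delta> E (real (covering_number \<delta> E))" by (rule coverable_covering_number)
  then obtain P where P: "finite P" "card P \<le> covering_number \<delta> E" "E \<subseteq> (\<Union>a\<in>P. cbox a (a + (\<chi> i. \<delta>)))"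
    by (auto simp: coverable_def)
  then have "\<forall>x\<in>X. \<exists>a. a \<in> P \<and> x \<in> cbox a (a + (\<chi> i. \<delta>))" using assms(4) by blast
  from bchoice[OF this] obtain g where g: "\<And>x. x \<in> X \<Longrightarrow> g x \<in> P"
    and gc: "\<And>x. x \<in> X \<Longrightarrow> x \<in> cbox (g x) (g x + (\<chi> i. \<delta>))" by blast
  have "inj_on g X"
  proof (rule inj_onI, rule ccontr)
    fix x y assume xy: "x \<in> X" "y \<in> X" "g x = g y" "x \<noteq> y"
    have "\<bar>(x - y) $ k\<bar> \<le> \<delta>" for k
      using gc[OF xy(1)] gc[OF xy(2)] xy(3) by (auto simp: mem_box_cart abs_le_iff dest!: spec[of _ k])
    then have "((x - y) $ 1)\<^sup>2 + ((x - y) $ 2)\<^sup>2 \<le> \<delta>\<^sup>2 + \<delta>\<^sup>2"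
      using assms(2) by (intro add_mono) (simp_all only: abs_le_square_iff[symmetric], simp_all)
    then have "(dist x y)\<^sup>2 \<le> 2 * \<delta>\<^sup>2"
      unfolding dist_norm power2_norm_eq_inner by (simp add: inner_2 power2_eq_square)
    moreover have "(2 * \<delta>)\<^sup>2 \<le> (dist x y)\<^sup>2" using sep[OF xy(1,2,4)] assms(2) by (intro power_mono) auto
    moreover have "0 < \<delta>\<^sup>2" using assms(2) by simp
    ultimately show False by (simp add: power_mult_distrib)
  qed
  then have "card X \<le> card P" using P(1) g by (intro card_inj_on_le[of g]) auto
  then show ?thesis using P(2) by simp
qed

text \<open>The image lies in a rectangle of length \<open>2 * stretch A * r\<close> and half thickness at most \<open>n * \<delta>\<close>.
Discs of radius \<open>(n + 1) * \<delta>\<close> centred at the multiples of \<open>\<delta>\<close> along its long axis cover it.\<close>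

lemma coverable_affine_image_cball:
  assumes A: "invertible A" and \<delta>: "0 < \<delta>" and r: "0 \<le> r" "squeeze A * r \<le> real n * \<delta>"
  shows "coverable \<delta> ((\<lambda>x. A *v x + b) ` cball p r)
    (12 * (real n + 1)\<^sup>2 * (stretch A * r / \<delta> + 1))"
proof -
  obtain e where e: "norm e = 1"
    and long: "\<And>z. \<bar>(A *v z) \<bullet> e\<bar> \<le> stretch A * norm z"
    and short: "\<And>z. \<bar>(A *v z) \<bullet> perp e\<bar> \<le> squeeze A * norm z"
    using matrix_image_in_strip[OF A] by metis
  define q where "q = A *v p + b"
  define m where "m = \<lceil>stretch A * r / \<delta>\<rceil>"
  define c where "c k = q + (real_of_int k * \<delta>) *\<^sub>R e" for k
  have m: "0 \<le> m" "stretch A * r / \<delta> \<le> of_int m" "of_int m \<le> stretch A * r / \<delta> + 1"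
  proof -
    have "0 \<le> stretch A * r / \<delta>" using r \<delta> stretch_nonneg[of A] by simp
    then show "0 \<le> m" "stretch A * r / \<delta> \<le> of_int m" "of_int m \<le> stretch A * r / \<delta> + 1"
      unfolding m_def by linarith+
  qed
  have cov: "coverable \<delta> (\<Union>k\<in>{-m..m}. cball (c k) (real (n + 1) * \<delta>)) (\<Sum>k\<in>{-m..m}. 4 * (real (n + 1))\<^sup>2)"
    by (intro coverable_UN coverable_cball \<delta>) auto
  have sub: "(\<lambda>x. A *v x + b) ` cball p r \<subseteq> (\<Union>k\<in>{-m..m}. cball (c k) (real (n + 1) * \<delta>))"
  proof (intro image_subsetI)
    fix x assume "x \<in> cball p r"
    then have z: "norm (x - p) \<le> r" by (simp add: dist_norm norm_minus_commute)
    define y where "y = A *v (x - p)"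
    have y: "A *v x + b = q + y" by (simp add: y_def q_def matrix_vector_mult_diff_distrib)
    have ye: "\<bar>y \<bullet> e\<bar> \<le> stretch A * r"
      using long[of "x - p"] mult_left_mono[OF z stretch_nonneg[of A]] by (simp add: y_def)
    have yp: "\<bar>y \<bullet> perp e\<bar> \<le> real n * \<delta>"
      using short[of "x - p"] mult_left_mono[OF z, of "squeeze A"] less_imp_le[OF squeeze_pos[OF A]] r(2) by (simp add: y_def)
    define k where "k = \<lfloor>y \<bullet> e / \<delta>\<rfloor>"
    have k: "real_of_int k * \<delta> \<le> y \<bullet> e" "y \<bullet> e \<le> real_of_int k * \<delta> + \<delta>"
      using \<delta> floor_divide_lower[of \<delta> "y \<bullet> e"] floor_divide_upper[of \<delta> "y \<bullet> e"]
      by (simp_all add: k_def algebra_simps)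
    have "\<bar>y \<bullet> e / \<delta>\<bar> \<le> stretch A * r / \<delta>" using ye \<delta> by (simp add: divide_right_mono)
    then have "k \<in> {-m..m}" unfolding k_def atLeastAtMost_iff using m(2) by linarith
    moreover have "A *v x + b \<in> cball (c k) (real (n + 1) * \<delta>)"
    proof -
      have "q + y - c k = (y \<bullet> e - real_of_int k * \<delta>) *\<^sub>R e + (y \<bullet> perp e) *\<^sub>R perp e"
        using perp_decomposition[OF e, of y] by (simp add: c_def algebra_simps)
      then have "norm (q + y - c k) \<le> \<bar>y \<bullet> e - real_of_int k * \<delta>\<bar> + \<bar>y \<bullet> perp e\<bar>"
        using norm_triangle_ineq[of "(y \<bullet> e - real_of_int k * \<delta>) *\<^sub>R e" "(y \<bullet> perp e) *\<^sub>R perp e"] e by simp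
      also have "\<dots> \<le> real (n + 1) * \<delta>" using k yp by (simp add: algebra_simps)
      finally show ?thesis by (simp add: y dist_norm norm_minus_commute)
    qed
    ultimately show "A *v x + b \<in> (\<Union>k\<in>{-m..m}. cball (c k) (real (n + 1) * \<delta>))" by blast
  qed
  have "(\<Sum>k\<in>{-m..m}. 4 * (real (n + 1))\<^sup>2) = (2 * of_int m + 1) * (4 * (real n + 1)\<^sup>2)"
    using m(1) by (simp add: add.commute)
  also have "\<dots> \<le> (3 * (stretch A * r / \<delta> + 1)) * (4 * (real n + 1)\<^sup>2)"
  proof (intro mult_right_mono)
    have "0 \<le> stretch A * r / \<delta>" using r \<delta> stretch_nonneg[of A] by simp
    then show "2 * of_int m + 1 \<le> 3 * (stretch A * r / \<delta> + 1)" using m(3) by simp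
  qed simp
  also have "\<dots> = 12 * (real n + 1)\<^sup>2 * (stretch A * r / \<delta> + 1)" by (simp add: algebra_simps)
  finally show ?thesis by (rule coverable_subset[OF cov sub])
qed

lemma cube_subset_cball:
  fixes a :: "real ^ 2"
  assumes "0 \<le> r" shows "cbox a (a + (\<chi> i. r)) \<subseteq> cball a (2 * r)"
proof
  fix x assume "x \<in> cbox a (a + (\<chi> i. r))"
  then have "a $ k \<le> x $ k \<and> x $ k \<le> a $ k + r" for k by (simp add: mem_box_cart)
  from this[of 1] this[of 2] have "\<bar>(x - a) $ 1\<bar> \<le> r" "\<bar>(x - a) $ 2\<bar> \<le> r" by auto
  then have "norm (x - a) \<le> 2 * r" using norm_le_l1_cart[of "x - a"] by (simp add: sum_2)
  then show "x \<in> cball a (2 * r)" by (simp add: dist_norm norm_minus_commute)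
qed

section \<open>Growth rates of covering numbers and box dimensions\<close>

lemma tendsto_scaling_exponent:
  "((\<lambda>\<delta>. ereal (t + ln K / (- ln \<delta>))) \<longlongrightarrow> ereal t) (at_right (0 :: real))"
proof -
  have "LIM \<delta> at_right (0 :: real). - ln \<delta> :> at_top"
    using ln_at_0 by (simp add: filterlim_uminus_at_top)
  then have "((\<lambda>\<delta>. ln K / (- ln \<delta>)) \<longlongrightarrow> 0) (at_right (0 :: real))"
    by (intro tendsto_divide_0[OF tendsto_const] filterlim_at_top_imp_at_infinity)
  then have "((\<lambda>\<delta>. t + ln K / (- ln \<delta>)) \<longlongrightarrow> t + 0) (at_right (0 :: real))"
    by (intro tendsto_intros)
  then show ?thesis by simp
qed

lemma eventually_scale: "eventually (\<lambda>\<delta>. 0 < \<delta> \<and> \<delta> < r) (at_right (0 :: real))" if "0 < r"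
  using that by (simp add: eventually_at_right_field) blast

lemma upper_box_dim_le:
  assumes E: "bounded E" "E \<noteq> {}" and K: "0 < K"
    and cov: "\<And>\<delta>. 0 < \<delta> \<Longrightarrow> \<delta> < 1 \<Longrightarrow> coverable \<delta> E (K * \<delta> powr (- t))"
  shows "upper_box_dim E \<le> ereal t"
proof -
  have "upper_box_dim E \<le> Limsup (at_right 0) (\<lambda>\<delta>. ereal (t + ln K / (- ln \<delta>)))"
    unfolding upper_box_dim_def
  proof (rule Limsup_mono, rule eventually_mono[OF eventually_scale[of 1]])
    fix \<delta> :: real assume \<delta>: "0 < \<delta> \<and> \<delta> < 1"
    have "1 \<le> real (covering_number \<delta> E)"
      using covering_number_pos[OF E, of \<delta>] \<delta> by simp
    moreover have "real (covering_number \<delta> E) \<le> K * \<delta> powr (- t)"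
      using cov \<delta> by (intro covering_number_le) auto
    ultimately have "ln (real (covering_number \<delta> E)) \<le> ln (K * \<delta> powr (- t))"
      by (intro ln_mono) auto
    also have "\<dots> = ln K + t * (- ln \<delta>)" using K \<delta> by (simp add: ln_mult ln_powr)
    finally have "ln (real (covering_number \<delta> E)) / (- ln \<delta>) \<le> (ln K + t * (- ln \<delta>)) / (- ln \<delta>)"
      using \<delta> by (intro divide_right_mono) auto
    also have "(ln K + t * (- ln \<delta>)) / (- ln \<delta>) = t + ln K / (- ln \<delta>)"
      using \<delta> by (simp add: field_simps)
    finally show "ereal (ln (real (covering_number \<delta> E)) / (- ln \<delta>)) \<le> ereal (t + ln K / (- ln \<delta>))"
      by simp
  qed simp
  also have "\<dots> = ereal t"
    by (intro lim_imp_Limsup tendsto_scaling_exponent) simp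
  finally show ?thesis .
qed

lemma lower_box_dim_ge:
  assumes K: "0 < K" "0 < r"
    and cov: "\<And>\<delta>. 0 < \<delta> \<Longrightarrow> \<delta> < r \<Longrightarrow> K * \<delta> powr (- t) \<le> real (covering_number \<delta> E)"
  shows "ereal t \<le> lower_box_dim E"
proof -
  have "ereal t = Liminf (at_right 0) (\<lambda>\<delta>. ereal (t + ln K / (- ln \<delta>)))"
    by (intro lim_imp_Liminf[symmetric] tendsto_scaling_exponent) simp
  also have "\<dots> \<le> lower_box_dim E"
    unfolding lower_box_dim_def
  proof (rule Liminf_mono, rule eventually_mono[OF eventually_scale[of "min r 1"]])
    fix \<delta> :: real assume \<delta>: "0 < \<delta> \<and> \<delta> < min r 1"
    have "ln K + t * (- ln \<delta>) = ln (K * \<delta> powr (- t))" using K \<delta> by (simp add: ln_mult ln_powr)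
    also have "\<dots> \<le> ln (real (covering_number \<delta> E))"
      using cov[of \<delta>] K \<delta> by (intro ln_mono) auto
    finally have le: "(ln K + t * (- ln \<delta>)) / (- ln \<delta>) \<le> ln (real (covering_number \<delta> E)) / (- ln \<delta>)"
      using \<delta> by (intro divide_right_mono) auto
    have "t + ln K / (- ln \<delta>) = (ln K + t * (- ln \<delta>)) / (- ln \<delta>)"
      using \<delta> by (simp add: field_simps)
    with le show "ereal (t + ln K / (- ln \<delta>)) \<le> ereal (ln (real (covering_number \<delta> E)) / (- ln \<delta>))"
      by simp
  qed (use K in simp)
  finally show ?thesis .
qed

lemma upper_box_dim_mono:
  fixes E :: "(real ^ 2) set"
  assumes "bounded E" "E' \<subseteq> E" "E' \<noteq> {}"
  shows "upper_box_dim E' \<le> upper_box_dim E"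
  unfolding upper_box_dim_def
proof (rule Limsup_mono, rule eventually_mono[OF eventually_scale[of 1]])
  fix \<delta> :: real assume \<delta>: "0 < \<delta> \<and> \<delta> < 1"
  then have "1 \<le> real (covering_number \<delta> E')" "real (covering_number \<delta> E') \<le> real (covering_number \<delta> E)"
    using covering_number_pos[of E' \<delta>] covering_number_mono[OF assms(1,2), of \<delta>] bounded_subset assms by auto
  then show "ereal (ln (real (covering_number \<delta> E')) / (- ln \<delta>)) \<le> ereal (ln (real (covering_number \<delta> E)) / (- ln \<delta>))"
    using \<delta> by (auto intro!: divide_right_mono_neg ln_mono simp: divide_right_mono)
qed simp

lemma lower_box_dim_mono:
  fixes E :: "(real ^ 2) set"
  assumes "bounded E" "E' \<subseteq> E" "E' \<noteq> {}"
  shows "lower_box_dim E' \<le> lower_box_dim E"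
  unfolding lower_box_dim_def
proof (rule Liminf_mono, rule eventually_mono[OF eventually_scale[of 1]])
  fix \<delta> :: real assume \<delta>: "0 < \<delta> \<and> \<delta> < 1"
  then have "1 \<le> real (covering_number \<delta> E')" "real (covering_number \<delta> E') \<le> real (covering_number \<delta> E)"
    using covering_number_pos[of E' \<delta>] covering_number_mono[OF assms(1,2), of \<delta>] bounded_subset assms by auto
  then show "ereal (ln (real (covering_number \<delta> E')) / (- ln \<delta>)) \<le> ereal (ln (real (covering_number \<delta> E)) / (- ln \<delta>))"
    using \<delta> by (auto intro!: divide_right_mono_neg ln_mono simp: divide_right_mono)
qed simp

lemma lower_le_upper_box_dim: "lower_box_dim E \<le> upper_box_dim E"
  unfolding lower_box_dim_def upper_box_dim_def by (rule Liminf_le_Limsup) simp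

text \<open>The dimension controls only small scales; on the remaining scales a single cover at a fixed
scale is good enough, and its size goes into the constant.\<close>

lemma coverable_of_upper_box_dim_less:
  assumes E: "bounded E" "E \<noteq> {}" and t: "0 \<le> t" "upper_box_dim E < ereal t"
  obtains K where "0 < K" "\<And>\<delta>. 0 < \<delta> \<Longrightarrow> \<delta> < 1 \<Longrightarrow> coverable \<delta> E (K * \<delta> powr (- t))"
proof -
  have "eventually (\<lambda>\<delta>. ereal (ln (real (covering_number \<delta> E)) / (- ln \<delta>)) < ereal t) (at_right 0)"
    using t(2) unfolding upper_box_dim_def by (rule Limsup_lessD)
  then obtain r0 where r0: "0 < r0"
    and dim: "\<And>\<delta>. 0 < \<delta> \<Longrightarrow> \<delta> < r0 \<Longrightarrow> ln (real (covering_number \<delta> E)) / (- ln \<delta>) < t"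
    unfolding eventually_at_right_field by auto
  obtain K0 where K0: "0 < K0" "\<And>\<delta>. 0 < \<delta> \<Longrightarrow> \<delta> \<le> 1 \<Longrightarrow> coverable \<delta> E (K0 / \<delta>\<^sup>2)"
    using coverable_bounded[OF E(1)] by metis
  define K where "K = 1 + K0 / r0\<^sup>2"
  have "coverable \<delta> E (K * \<delta> powr (- t))" if \<delta>: "0 < \<delta>" "\<delta> < 1" for \<delta>
  proof (cases "\<delta> < r0")
    case True
    have N: "1 \<le> real (covering_number \<delta> E)" using covering_number_pos[OF E, of \<delta>] \<delta> by simp
    have "ln (real (covering_number \<delta> E)) < t * (- ln \<delta>)"
      using dim[OF \<delta>(1) True] \<delta> by (simp add: divide_simps mult.commute)
    also have "\<dots> = ln (\<delta> powr (- t))" using \<delta> by (simp add: ln_powr)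
    finally have "real (covering_number \<delta> E) \<le> 1 * \<delta> powr (- t)"
      using N \<delta> by (subst (asm) ln_less_cancel_iff) auto
    also have "\<dots> \<le> K * \<delta> powr (- t)"
      using K0(1) by (intro mult_right_mono) (auto simp: K_def)
    finally show ?thesis
      using K0(2)[of \<delta>] \<delta> coverable_covering_number coverable_subset[OF _ order_refl] by fastforce
  next
    case False
    have "K0 / \<delta>\<^sup>2 \<le> K0 / r0\<^sup>2"
      using False r0 K0(1) \<delta> by (intro divide_left_mono power_mono) auto
    also have "\<dots> \<le> K * 1" using r0 by (simp add: K_def)
    also have "\<dots> \<le> K * \<delta> powr (- t)"
      using t(1) \<delta> K0(1) powr_mono2'[of "-t" \<delta> 1] by (intro mult_left_mono) (auto simp: K_def)
    finally show ?thesis using coverable_subset[OF K0(2)[of \<delta>] order_refl] \<delta> by simp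
  qed
  moreover have "0 < K" using K0(1) by (simp add: K_def add_pos_nonneg)
  ultimately show thesis using that by blast
qed

section \<open>Separated points in connected planar sets\<close>

text \<open>Cramer's rule for the coordinates of \<open>v\<close>, as \<open>perp a \<bullet> b\<close> is the determinant with columns \<open>a\<close> and
\<open>b\<close>.\<close>

lemma cramer_perp: "(perp a \<bullet> b) *\<^sub>R v = (v \<bullet> b) *\<^sub>R perp a - (v \<bullet> a) *\<^sub>R perp b"
  by (simp add: vec_eq_iff forall_2 inner_2 algebra_simps)

lemma not_collinear_obtain:
  fixes K :: "(real ^ 2) set"
  assumes "\<not> collinear K"
  obtains p q r where "p \<in> K" "q \<in> K" "r \<in> K" "perp (q - p) \<bullet> (r - p) \<noteq> 0"
proof (rule ccontr)
  assume "\<not> thesis"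
  then have zero: "perp (q - p) \<bullet> (r - p) = 0" if "p \<in> K" "q \<in> K" "r \<in> K" for p q r
    using that \<open>\<And>p q r. \<lbrakk>p \<in> K; q \<in> K; r \<in> K; perp (q - p) \<bullet> (r - p) \<noteq> 0\<rbrakk> \<Longrightarrow> thesis\<close> by blast
  obtain p q where pq: "p \<in> K" "q \<in> K" "p \<noteq> q"
    using assms unfolding collinear_def by (metis cancel_comm_monoid_add_class.diff_cancel scaleR_zero_left)
  define u where "u = q - p"
  have u: "u \<bullet> u \<noteq> 0" using pq by (simp add: u_def)
  have "\<exists>c. x - y = c *\<^sub>R u" if "x \<in> K" "y \<in> K" for x y
  proof -
    have "(x - y) \<bullet> perp u = 0"
      using zero[OF pq(1,2) that(1)] zero[OF pq(1,2) that(2)]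
      by (simp add: u_def inner_commute inner_diff_right inner_diff_left)
    then have "(u \<bullet> u) *\<^sub>R (x - y) = ((x - y) \<bullet> u) *\<^sub>R u"
      by (simp add: perp_decomposition_general[of u "x - y"])
    then have "x - y = (((x - y) \<bullet> u) / (u \<bullet> u)) *\<^sub>R u"
      using u by (metis (no_types, lifting) divide_inverse_commute scaleR_left_imp_eq scaleR_one scaleR_scaleR right_inverse mult.commute)
    then show ?thesis by blast
  qed
  then have "collinear K" unfolding collinear_def by blast
  with assms show False by simp
qed

text \<open>If \<open>a\<close> and \<open>b\<close> are two independent differences of points of \<open>K\<close>, then \<open>cramer_perp\<close> recovers \<open>v\<close> from
\<open>v \<bullet> a\<close> and \<open>v \<bullet> b\<close>. So these cannot both be small compared with \<open>norm v\<close>.\<close>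

lemma not_collinear_width:
  fixes K :: "(real ^ 2) set"
  assumes "\<not> collinear K"
  obtains L where "0 < L" "\<And>v. \<exists>x\<in>K. \<exists>y\<in>K. L * norm v \<le> v \<bullet> (y - x)"
proof -
  obtain p q r where K: "p \<in> K" "q \<in> K" "r \<in> K" and D: "perp (q - p) \<bullet> (r - p) \<noteq> 0"
    using not_collinear_obtain[OF assms] by metis
  define a where "a = q - p"
  define b where "b = r - p"
  define L where "L = \<bar>perp a \<bullet> b\<bar> / (norm a + norm b)"
  have pos: "0 < norm a + norm b" using D unfolding a_def b_def by (metis add_pos_nonneg inner_zero_left norm_ge_zero norm_perp norm_zero zero_less_norm_iff norm_eq_zero)
  have "\<exists>x\<in>K. \<exists>y\<in>K. L * norm v \<le> v \<bullet> (y - x)" for v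
  proof -
    have "\<bar>perp a \<bullet> b\<bar> * norm v = norm ((v \<bullet> b) *\<^sub>R perp a - (v \<bullet> a) *\<^sub>R perp b)"
      unfolding cramer_perp[symmetric] by simp
    also have "\<dots> \<le> \<bar>v \<bullet> b\<bar> * norm a + \<bar>v \<bullet> a\<bar> * norm b"
      using norm_triangle_ineq4[of "(v \<bullet> b) *\<^sub>R perp a" "(v \<bullet> a) *\<^sub>R perp b"] by simp
    also have "\<dots> \<le> max \<bar>v \<bullet> a\<bar> \<bar>v \<bullet> b\<bar> * norm a + max \<bar>v \<bullet> a\<bar> \<bar>v \<bullet> b\<bar> * norm b"
      by (intro add_mono mult_right_mono) auto
    finally have "L * norm v \<le> max \<bar>v \<bullet> a\<bar> \<bar>v \<bullet> b\<bar>"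
      using pos by (simp add: L_def field_simps)
    then have "L * norm v \<le> v \<bullet> (q - p) \<or> L * norm v \<le> v \<bullet> (p - q) \<or>
        L * norm v \<le> v \<bullet> (r - p) \<or> L * norm v \<le> v \<bullet> (p - r)"
      unfolding a_def b_def inner_diff_right by linarith
    then show ?thesis using K by blast
  qed
  moreover have "0 < L" using D pos by (simp add: L_def a_def b_def)
  ultimately show thesis using that by blast
qed

text \<open>The image \<open>f ` K\<close> contains an interval of length \<open>l\<close>. Preimages of equally spaced values in it are as
far apart as the values, since \<open>f\<close> is 1-Lipschitz.\<close>

lemma connected_separated_points:
  fixes f :: "'a::metric_space \<Rightarrow> real"
  assumes K: "connected K" "x \<in> K" "y \<in> K" and f: "continuous_on K f"
    and lip: "\<And>u v. \<bar>f u - f v\<bar> \<le> dist u v"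
    and l: "l \<le> f y - f x" "0 \<le> l" and h: "0 < h"
  shows "\<exists>X. finite X \<and> X \<subseteq> K \<and> l / h \<le> real (card X) \<and>
    (\<forall>u\<in>X. \<forall>v\<in>X. u \<noteq> v \<longrightarrow> h \<le> dist u v)"
proof -
  define n where "n = nat \<lfloor>l / h\<rfloor>"
  have n: "real n \<le> l / h" "l / h \<le> real (Suc n)" proof -
    have "0 \<le> l / h" using l(2) h by simp
    then show "real n \<le> l / h" "l / h \<le> real (Suc n)" unfolding n_def by linarith+
  qed
  have "\<exists>z\<in>K. f z = f x + real i * h" if "i \<le> n" for i
  proof -
    have "real i * h \<le> real n * h" using that h by (intro mult_right_mono) auto
    also have "\<dots> \<le> l" using n(1) h by (simp add: field_simps)
    finally have "f x + real i * h \<in> {f x..f y}" using l h by simp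
    moreover have "{f x..f y} \<subseteq> f ` K"
      using connected_continuous_image[OF f K(1)] K by (intro connected_contains_Icc) auto
    ultimately show ?thesis by (metis imageE subsetD)
  qed
  then have "\<forall>i\<in>{..n}. \<exists>z. z \<in> K \<and> f z = f x + real i * h" by (simp add: Bex_def)
  from bchoice[OF this] obtain g where g: "\<And>i. i \<le> n \<Longrightarrow> g i \<in> K" "\<And>i. i \<le> n \<Longrightarrow> f (g i) = f x + real i * h"
    by auto
  have sep: "h \<le> dist (g i) (g j)" if "i \<le> n" "j \<le> n" "i \<noteq> j" for i j
  proof -
    have "1 * h \<le> \<bar>real i - real j\<bar> * h" using that h by (intro mult_right_mono) auto
    also have "\<dots> = \<bar>f (g i) - f (g j)\<bar>" using g that h by (simp add: abs_mult flip: left_diff_distrib)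
    also have "\<dots> \<le> dist (g i) (g j)" by (rule lip)
    finally show ?thesis by simp
  qed
  have inj: "inj_on g {..n}"
  proof (rule inj_onI, rule ccontr)
    fix i j assume "i \<in> {..n}" "j \<in> {..n}" "g i = g j" "i \<noteq> j"
    then show False using sep[of i j] h by simp
  qed
  show ?thesis
  proof (intro exI[of _ "g ` {..n}"] conjI)
    show "finite (g ` {..n})" "g ` {..n} \<subseteq> K" using g by auto
    show "l / h \<le> real (card (g ` {..n}))" using n by (simp add: card_image[OF inj])
    show "\<forall>u\<in>g ` {..n}. \<forall>v\<in>g ` {..n}. u \<noteq> v \<longrightarrow> h \<le> dist u v"
      using sep by auto
  qed
qed

section \<open>Affine maps indexed by words\<close>

lemma linear_part_affine: "linear_part (\<lambda>x. A *v x + b) = A"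
  by (simp add: linear_part_def)

lemma linear_part_id [simp]: "linear_part id = mat 1" "linear_part (\<lambda>x. x) = mat 1"
  using linear_part_affine[of "mat 1" 0] by (simp_all add: id_def)

lemma word_map_simps [simp]:
  "word_map S [] = id" "word_map S (i # w) = S i \<circ> word_map S w"
  by (simp_all add: word_map_def)

lemma word_map_append: "word_map S (v @ w) = word_map S v \<circ> word_map S w"
  by (induction v) (simp_all add: o_assoc)

definition words_below :: "nat \<Rightarrow> nat \<Rightarrow> nat list set" where
  "words_below N m = {w. set w \<subseteq> {1..N} \<and> length w < m}"

lemma finite_words: "finite (words N k)"
  unfolding words_def by (intro finite_lists_length_eq) simp

lemma finite_words_below: "finite (words_below N m)"
  by (rule finite_subset[OF _ finite_lists_length_le[of "{1..N}" m]]) (auto simp: words_below_def)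

locale planar_IFS =
  fixes N :: nat and S :: "nat \<Rightarrow> real ^ 2 \<Rightarrow> real ^ 2"
  assumes ifs: "affine_IFS N S"
begin

abbreviation lin :: "nat list \<Rightarrow> real ^ 2 ^ 2" where
  "lin w \<equiv> linear_part (word_map S w)"

abbreviation is_word :: "nat list \<Rightarrow> bool" where
  "is_word w \<equiv> set w \<subseteq> {1..N}"

definition ratio :: real where
  "ratio = (SOME c. 0 < c \<and> c < 1 \<and>
     (\<forall>i\<in>{1..N}. \<forall>x y. norm (S i x - S i y) \<le> c * norm (x - y)))"

lemma ratio: "0 < ratio" "ratio < 1"
  and contraction: "i \<in> {1..N} \<Longrightarrow> norm (S i x - S i y) \<le> ratio * norm (x - y)"
proof -
  have "\<forall>i\<in>{1..N}. \<exists>c. 0 < c \<and> c < 1 \<and> (\<forall>x y. norm (S i x - S i y) \<le> c * norm (x - y))"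
    using ifs by (simp add: affine_IFS_def)
  from bchoice[OF this] obtain c where c: "\<And>i. i \<in> {1..N} \<Longrightarrow> 0 < c i \<and> c i < 1"
    and lip: "\<And>i x y. i \<in> {1..N} \<Longrightarrow> norm (S i x - S i y) \<le> c i * norm (x - y)" by blast
  have N: "{1..N} \<noteq> {}" using ifs by (simp add: affine_IFS_def)
  define d where "d = Max (c ` {1..N})"
  have "d \<in> c ` {1..N}" unfolding d_def using N by (intro Max_in) auto
  then have d: "0 < d" "d < 1" using c by auto
  have "norm (S i x - S i y) \<le> d * norm (x - y)" if "i \<in> {1..N}" for i x y
  proof -
    have "c i \<le> d" unfolding d_def using that by (intro Max_ge) auto
    then show ?thesis using lip[OF that, of x y] mult_right_mono[of "c i" d "norm (x - y)"] by simp
  qed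
  then have ex: "\<exists>c. 0 < c \<and> c < 1 \<and> (\<forall>i\<in>{1..N}. \<forall>x y. norm (S i x - S i y) \<le> c * norm (x - y))"
    using d by blast
  from someI_ex[OF ex] show "0 < ratio" "ratio < 1"
    and "i \<in> {1..N} \<Longrightarrow> norm (S i x - S i y) \<le> ratio * norm (x - y)"
    unfolding ratio_def by blast+
qed

lemma letter_affine:
  assumes "i \<in> {1..N}"
  obtains A b where "invertible A" "S i = (\<lambda>x. A *v x + b)"
  using ifs assms unfolding affine_IFS_def by blast

lemma word_affine:
  assumes "is_word w"
  shows "\<exists>b. word_map S w = (\<lambda>x. lin w *v x + b) \<and> invertible (lin w)"
  using assms
proof (induction w)
  case Nil
  have "word_map S [] = (\<lambda>x. mat 1 *v x + 0)" by (simp add: fun_eq_iff)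
  then have "lin [] = mat 1" by (metis linear_part_affine)
  moreover have "invertible (mat 1 :: real ^ 2 ^ 2)" by (simp add: invertible_det_nz)
  ultimately show ?case by (metis \<open>word_map S [] = (\<lambda>x. mat 1 *v x + 0)\<close>)
next
  case (Cons i w)
  then obtain b where b: "word_map S w = (\<lambda>x. lin w *v x + b)" "invertible (lin w)" by auto
  obtain A a where A: "invertible A" "S i = (\<lambda>x. A *v x + a)" using letter_affine[of i] Cons.prems by auto
  have eq: "word_map S (i # w) = (\<lambda>x. (A ** lin w) *v x + (A *v b + a))"
    unfolding word_map_simps A(2) by (subst b(1)) (simp add: fun_eq_iff matrix_vector_right_distrib matrix_vector_mul_assoc)
  then have "lin (i # w) = A ** lin w" by (metis linear_part_affine)
  then show ?case using eq invertible_mult[OF A(1) b(2)] by metis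
qed

lemma word_map_eq: "is_word w \<Longrightarrow> word_map S w x = lin w *v x + word_map S w 0"
  using word_affine[of w] by (metis add_0 matrix_vector_mult_0_right)

lemma invertible_lin: "is_word w \<Longrightarrow> invertible (lin w)"
  using word_affine by blast

lemma lin_append:
  assumes "is_word v" "is_word w"
  shows "lin (v @ w) = lin v ** lin w"
proof -
  obtain a b where "word_map S v = (\<lambda>x. lin v *v x + a)" "word_map S w = (\<lambda>x. lin w *v x + b)"
    using word_affine assms by metis
  then have "word_map S (v @ w) = (\<lambda>x. (lin v ** lin w) *v x + (lin v *v b + a))"
    unfolding word_map_append
    by (metis (no_types, lifting) ab_semigroup_add_class.add_ac(1) comp_apply matrix_vector_mul_assoc matrix_vector_right_distrib)
  then show ?thesis by (metis linear_part_affine)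
qed

lemma inj_word_map: "is_word w \<Longrightarrow> inj (word_map S w)"
  using inj_matrix_vector_mult[OF invertible_lin] word_affine[of w]
  by (metis (no_types, lifting) add_right_cancel injD injI)

lemma word_map_lipschitz:
  "is_word w \<Longrightarrow> norm (word_map S w x - word_map S w y) \<le> ratio ^ length w * norm (x - y)"
proof (induction w)
  case (Cons i w)
  have "norm (word_map S (i # w) x - word_map S (i # w) y) \<le> ratio * norm (word_map S w x - word_map S w y)"
    using contraction[of i] Cons.prems by simp
  also have "\<dots> \<le> ratio * (ratio ^ length w * norm (x - y))"
    using Cons ratio by (intro mult_left_mono) auto
  finally show ?case by (simp add: mult_ac)
qed simp

lemma stretch_lin_le: "is_word w \<Longrightarrow> stretch (lin w) \<le> ratio ^ length w"
proof (rule stretch_le)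
  fix x assume w: "is_word w"
  show "norm (lin w *v x) \<le> ratio ^ length w * norm x"
    using word_map_lipschitz[OF w, of x 0] word_map_eq[OF w, of x] by simp
qed

lemma squeeze_lin_le: "is_word w \<Longrightarrow> squeeze (lin w) \<le> ratio ^ length w"
  using squeeze_le_stretch[OF invertible_lin] stretch_lin_le by (meson order_trans)

lemma stretch_lin_le_1: "is_word w \<Longrightarrow> stretch (lin w) \<le> 1"
  using stretch_lin_le[of w] power_le_one[of ratio "length w"] ratio by simp

definition letter_squeeze :: real where
  "letter_squeeze = Min ((\<lambda>i. squeeze (lin [i])) ` {1..N})"

lemma letter_squeeze_pos: "0 < letter_squeeze"
proof -
  have N: "{1..N} \<noteq> {}" using ifs by (simp add: affine_IFS_def)
  then have "letter_squeeze \<in> (\<lambda>i. squeeze (lin [i])) ` {1..N}" unfolding letter_squeeze_def by (intro Min_in) auto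
  then show ?thesis using squeeze_pos[OF invertible_lin] by (force simp del: word_map_simps)
qed

lemma squeeze_snoc_ge:
  assumes "is_word (w @ [i])"
  shows "letter_squeeze * squeeze (lin w) \<le> squeeze (lin (w @ [i]))"
proof -
  have w: "is_word w" "is_word [i]" using assms by auto
  have "letter_squeeze \<le> squeeze (lin [i])" unfolding letter_squeeze_def using w(2) by (intro Min_le) auto
  then have "letter_squeeze * squeeze (lin w) \<le> squeeze (lin w) * squeeze (lin [i])"
    using squeeze_pos[OF invertible_lin[OF w(1)]] by (simp del: word_map_simps add: mult.commute)
  also have "\<dots> \<le> squeeze (lin (w @ [i]))"
    unfolding lin_append[OF w] by (intro squeeze_mult_ge invertible_lin w)
  finally show ?thesis .
qed

lemma squeeze_append_le:
  assumes "is_word v" "is_word w"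
  shows "squeeze (lin (v @ w)) \<le> squeeze (lin v)"
proof -
  have "squeeze (lin (v @ w)) \<le> squeeze (lin v) * stretch (lin w)"
    unfolding lin_append[OF assms] using assms by (intro squeeze_mult_le invertible_lin)
  also have "\<dots> \<le> squeeze (lin v) * 1"
    using stretch_lin_le_1[OF assms(2)] less_imp_le[OF squeeze_pos[OF invertible_lin[OF assms(1)]]]
    by (intro mult_left_mono) auto
  finally show ?thesis by simp
qed

lemma phi_append_le:
  assumes "is_word v" "is_word w" "0 \<le> t"
  shows "phi t (lin (v @ w)) \<le> phi t (lin v) * phi t (lin w)"
  unfolding lin_append[OF assms(1,2)] using assms by (intro phi_mult_le invertible_lin)

section \<open>The affinity dimension as a critical exponent\<close>

definition phi_sum :: "nat \<Rightarrow> real \<Rightarrow> real" where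
  "phi_sum k t = (\<Sum>w\<in>words N k. phi t (lin w))"

definition phi_sum_below :: "nat \<Rightarrow> real \<Rightarrow> real" where
  "phi_sum_below m t = (\<Sum>w\<in>words_below N m. phi t (lin w))"

lemma phi_sum_below_Suc: "phi_sum_below (Suc m) t = phi_sum_below m t + phi_sum m t"
proof -
  have "words_below N (Suc m) = words_below N m \<union> words N m"
    by (auto simp: words_below_def words_def)
  moreover have "words_below N m \<inter> words N m = {}" by (auto simp: words_below_def words_def)
  ultimately show ?thesis
    by (simp add: phi_sum_below_def phi_sum_def sum.union_disjoint finite_words finite_words_below)
qed

lemma phi_lin_pos: "is_word w \<Longrightarrow> 0 \<le> t \<Longrightarrow> 0 < phi t (lin w)"
  by (intro phi_pos invertible_lin)

lemma phi_sum_nonneg: "0 \<le> t \<Longrightarrow> 0 \<le> phi_sum k t"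
  unfolding phi_sum_def by (rule sum_nonneg, rule less_imp_le, rule phi_lin_pos) (simp_all add: words_def)

lemma phi_sum_0_ge: "1 \<le> phi_sum k 0"
proof -
  have "replicate k 1 \<in> words N k" using ifs by (auto simp: words_def affine_IFS_def)
  then have "1 \<le> card (words N k)" using finite_words[of N k] card_gt_0_iff[of "words N k"] by auto
  then show ?thesis by (simp add: phi_sum_def phi_def)
qed

lemma phi_sum_decrease:
  assumes "1 \<le> k" "0 \<le> t" "t \<le> t'"
  shows "phi_sum k t' \<le> ratio powr (t' - t) * phi_sum k t"
  unfolding phi_sum_def sum_distrib_left
proof (intro sum_mono phi_decrease assms(2,3))
  fix w assume "w \<in> words N k"
  then have w: "is_word w" "length w = k" by (auto simp: words_def)
  show "invertible (lin w)" using w by (intro invertible_lin)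
  have "ratio ^ k \<le> ratio ^ 1" using ratio assms(1) by (intro power_decreasing) auto
  then show "stretch (lin w) \<le> ratio" using stretch_lin_le[OF w(1)] w(2) by simp
qed

lemma phi_sum_strict_decrease:
  assumes "1 \<le> k" "0 \<le> t" "t < t'" "0 < phi_sum k t"
  shows "phi_sum k t' < phi_sum k t"
proof -
  have "ratio powr (t' - t) < 1" using ratio assms(3) by (simp add: powr01_less_one)
  then have "ratio powr (t' - t) * phi_sum k t < 1 * phi_sum k t"
    using assms(4) by (intro mult_strict_right_mono)
  then show ?thesis using phi_sum_decrease[OF assms(1,2) less_imp_le[OF assms(3)]] by linarith
qed

lemma continuous_on_phi_sum: "continuous_on {0..} (phi_sum k)"
  unfolding phi_sum_def by (intro continuous_on_sum continuous_on_phi invertible_lin) (auto simp: words_def)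

text \<open>At \<open>t = 0\<close> the sum counts the words, so it is at least 1. It decreases strictly and continuously,
and by \<open>phi_sum_decrease\<close> it tends to 0.\<close>

lemma affinity_exponent_root:
  assumes k: "1 \<le> k"
  shows "0 \<le> affinity_exponent N S k \<and> phi_sum k (affinity_exponent N S k) = 1"
proof -
  have "\<exists>!t. 0 \<le> t \<and> phi_sum k t = 1"
  proof (rule ex_ex1I)
    obtain n where "ratio ^ n < 1 / phi_sum k 0"
      using real_arch_pow_inv[of "1 / phi_sum k 0" ratio] ratio phi_sum_0_ge[of k] by auto
    define T where "T = real n"
    have T: "0 \<le> T" "phi_sum k 0 * ratio powr T \<le> 1"
      using \<open>ratio ^ n < 1 / phi_sum k 0\<close> phi_sum_0_ge[of k] ratio
      by (simp_all add: T_def powr_realpow field_simps)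
    then have "phi_sum k T \<le> 1" using phi_sum_decrease[OF k, of 0 T] by (simp add: mult.commute)
    then show "\<exists>t. 0 \<le> t \<and> phi_sum k t = 1"
      using IVT2'[of "phi_sum k" T 1 0] T phi_sum_0_ge[of k]
        continuous_on_subset[OF continuous_on_phi_sum, of "{0..T}" k] by fastforce
  next
    fix t t' assume "0 \<le> t \<and> phi_sum k t = 1" "0 \<le> t' \<and> phi_sum k t' = 1"
    then show "t = t'"
      using phi_sum_strict_decrease[OF k, of t t'] phi_sum_strict_decrease[OF k, of t' t]
      by (cases t t' rule: linorder_cases) auto
  qed
  from theI'[OF this] show ?thesis unfolding affinity_exponent_def phi_sum_def by simp
qed

lemma phi_sum_less_1_iff:
  assumes "1 \<le> k" "0 \<le> t"
  shows "phi_sum k t < 1 \<longleftrightarrow> affinity_exponent N S k < t"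
proof -
  define r where "r = affinity_exponent N S k"
  have r: "0 \<le> r" "phi_sum k r = 1" using affinity_exponent_root[OF assms(1)] by (auto simp: r_def)
  show ?thesis
  proof
    assume "affinity_exponent N S k < t"
    then show "phi_sum k t < 1"
      using phi_sum_strict_decrease[OF assms(1) r(1), of t] r by (simp add: r_def)
  next
    assume "phi_sum k t < 1"
    then show "affinity_exponent N S k < t"
      using phi_sum_decrease[OF assms, of r] r phi_sum_nonneg[OF assms(2), of k] ratio
        powr_le1[of "r - t" ratio] mult_right_mono[of "ratio powr (r - t)" 1 "phi_sum k t"]
      by (cases "t \<le> r") (auto simp: r_def)
  qed
qed

text \<open>Both the words of a fixed length and the words stopped at a given scale are of this kind, so one
estimate for sums over such sets serves the convergence of the exponents and the lower bound.\<close>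

definition cut_set :: "nat list set \<Rightarrow> bool" where
  "cut_set J \<longleftrightarrow> finite J \<and> (\<forall>w\<in>J. is_word w) \<and>
     (\<exists>k0. \<forall>w. is_word w \<longrightarrow> k0 \<le> length w \<longrightarrow> (\<exists>j\<in>J. \<exists>v. w = j @ v))"

text \<open>Every word is either short or the product of a member of \<open>J\<close> and a word below the same length bound. By
submultiplicativity the partial sums \<open>T\<^sub>m\<close> satisfy \<open>T\<^sub>m \<le> R + b * T\<^sub>m\<close> with \<open>b < 1\<close> the sum over
\<open>J\<close>, so all of them are at most \<open>R / (1 - b)\<close>.\<close>

lemma phi_sum_below_bounded:
  assumes J: "cut_set J" and t: "0 \<le> t" and less: "(\<Sum>w\<in>J. phi t (lin w)) < 1"
  shows "\<exists>M. \<forall>m. phi_sum_below m t \<le> M"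
proof -
  define b where "b = (\<Sum>w\<in>J. phi t (lin w))"
  obtain k0 where fin: "finite J" and words: "\<And>w. w \<in> J \<Longrightarrow> is_word w"
    and cut: "\<And>w. is_word w \<Longrightarrow> k0 \<le> length w \<Longrightarrow> \<exists>j\<in>J. \<exists>v. w = j @ v"
    using J unfolding cut_set_def by blast
  have "phi_sum_below m t \<le> phi_sum_below k0 t / (1 - b)" for m
  proof -
    let ?P = "(\<lambda>(j, v). j @ v) ` (J \<times> words_below N m)"
    have nonneg: "0 \<le> phi t (lin w)" if "w \<in> words_below N k0 \<union> ?P" for w
    proof -
      have "is_word (j @ v)" if "j \<in> J" "v \<in> words_below N m" for j v
        using that words[of j] by (simp add: words_below_def)
      then have "is_word w" using that by (auto simp only: words_below_def)
      then show ?thesis using phi_lin_pos[OF _ t] by (simp add: less_imp_le)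
    qed
    have sub: "words_below N m \<subseteq> words_below N k0 \<union> ?P"
    proof
      fix w assume "w \<in> words_below N m"
      then have w: "is_word w" "length w < m" by (auto simp: words_below_def)
      show "w \<in> words_below N k0 \<union> ?P"
      proof (cases "length w < k0")
        case False
        then obtain j v where jv: "j \<in> J" "w = j @ v" using cut[OF w(1)] by auto
        then have "v \<in> words_below N m" using w by (auto simp: words_below_def)
        then show ?thesis using jv by force
      qed (use w in \<open>simp add: words_below_def\<close>)
    qed
    have fins: "finite (words_below N k0)" "finite ?P" using fin finite_words_below by auto
    have "phi_sum_below m t \<le> (\<Sum>w\<in>words_below N k0 \<union> ?P. phi t (lin w))"
      unfolding phi_sum_below_def using fins sub nonneg by (intro sum_mono2) auto
    also have "\<dots> \<le> (\<Sum>w\<in>words_below N k0. phi t (lin w)) + (\<Sum>w\<in>?P. phi t (lin w))"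
      using fins nonneg by (subst sum_Un) (auto intro!: sum_nonneg)
    also have "(\<Sum>w\<in>?P. phi t (lin w)) \<le> (\<Sum>p\<in>J \<times> words_below N m. phi t (lin (fst p @ snd p)))"
      using sum_image_le[of "J \<times> words_below N m" "\<lambda>w. phi t (lin w)" "\<lambda>(j, v). j @ v"] fin nonneg
      by (force simp: finite_words_below o_def case_prod_beta)
    also have "\<dots> \<le> (\<Sum>p\<in>J \<times> words_below N m. phi t (lin (fst p)) * phi t (lin (snd p)))"
      using words t by (intro sum_mono phi_append_le) (simp_all add: words_below_def mem_Times_iff)
    also have "\<dots> = b * phi_sum_below m t"
      unfolding b_def phi_sum_below_def sum_product sum.cartesian_product by (simp add: case_prod_beta)
    finally have "(1 - b) * phi_sum_below m t \<le> phi_sum_below k0 t"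
      by (simp add: phi_sum_below_def algebra_simps)
    then show ?thesis using less by (simp add: b_def divide_simps mult.commute)
  qed
  then show ?thesis by blast
qed

lemma cut_set_words: "cut_set (words N k)"
  unfolding cut_set_def
proof (intro conjI ballI exI allI impI)
  fix w assume "is_word w" "k \<le> length w"
  then show "\<exists>j\<in>words N k. \<exists>v. w = j @ v"
    using set_take_subset[of k w] by (intro bexI[of _ "take k w"] exI[of _ "drop k w"]) (auto simp: words_def)
qed (rule finite_words, simp add: words_def)

lemma eventually_phi_sum_less_1:
  assumes "\<forall>m. phi_sum_below m t \<le> M" "0 \<le> t"
  shows "eventually (\<lambda>k. phi_sum k t < 1) sequentially"
proof -
  have "(\<Sum>k<m. phi_sum k t) = phi_sum_below m t" for m
    by (induction m) (simp_all add: phi_sum_below_Suc, simp add: phi_sum_below_def words_below_def)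
  then have "summable (\<lambda>k. phi_sum k t)"
    using assms phi_sum_nonneg by (intro summableI_nonneg_bounded[of _ M]) auto
  then have "(\<lambda>k. phi_sum k t) \<longlonglongrightarrow> 0" by (rule summable_LIMSEQ_zero)
  then show ?thesis by (rule order_tendstoD) simp
qed

text \<open>If some exponent is below \<open>a\<close>, then the sum of \<open>phi a\<close> over the words of that length is less than 1,
so the sum over all words converges. Its terms tend to 0, which puts almost all exponents below
\<open>a\<close>.\<close>

lemma affinity_exponent_tendsto_Inf:
  "affinity_exponent N S \<longlonglongrightarrow> Inf (affinity_exponent N S ` {1..})" (is "_ \<longlonglongrightarrow> ?L")
proof (rule order_tendstoI)
  have bdd: "bdd_below (affinity_exponent N S ` {1..})"
    using affinity_exponent_root by (intro bdd_belowI[of _ 0]) auto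
  have ge: "?L \<le> affinity_exponent N S k" if "1 \<le> k" for k
    using that bdd by (intro cInf_lower) auto
  have L: "0 \<le> ?L" using affinity_exponent_root by (intro cInf_greatest) auto
  {
    fix a assume "a < ?L"
    then show "eventually (\<lambda>k. a < affinity_exponent N S k) sequentially"
      using ge eventually_mono[OF eventually_ge_at_top[of 1]] by (smt (verit) le_trans)
  next
    fix a assume a: "?L < a"
    then obtain k where k: "1 \<le> k" "affinity_exponent N S k < a"
      using cInf_lessD[of "affinity_exponent N S ` {1..}" a] by auto
    have a0: "0 \<le> a" using a L by simp
    have "phi_sum k a < 1" using k a0 by (simp add: phi_sum_less_1_iff)
    then have "\<exists>M. \<forall>m. phi_sum_below m a \<le> M"
      using phi_sum_below_bounded[OF cut_set_words a0] by (simp add: phi_sum_def)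
    then have "eventually (\<lambda>k. phi_sum k a < 1) sequentially"
      using eventually_phi_sum_less_1 a0 by blast
    then show "eventually (\<lambda>k. affinity_exponent N S k < a) sequentially"
      using eventually_ge_at_top[of 1] by eventually_elim (simp add: phi_sum_less_1_iff a0)
  }
qed

lemma affinity_dim_eq: "affinity_dim N S = Inf (affinity_exponent N S ` {1..})"
  unfolding affinity_dim_def by (rule limI[OF affinity_exponent_tendsto_Inf])

lemma affinity_dim_nonneg: "0 \<le> affinity_dim N S"
  unfolding affinity_dim_eq using affinity_exponent_root by (intro cInf_greatest) auto

lemma phi_sum_below_bounded_above_affinity_dim:
  assumes "affinity_dim N S < t"
  shows "\<exists>M. \<forall>m. phi_sum_below m t \<le> M"
proof -
  obtain k where k: "1 \<le> k" "affinity_exponent N S k < t"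
    using cInf_lessD[of "affinity_exponent N S ` {1..}" t] assms unfolding affinity_dim_eq by auto
  have t: "0 \<le> t" using assms affinity_dim_nonneg by simp
  then have "phi_sum k t < 1" using k by (simp add: phi_sum_less_1_iff)
  then show ?thesis using phi_sum_below_bounded[OF cut_set_words t] by (simp add: phi_sum_def)
qed

text \<open>A sum below 1 would make the series over all words converge and hence push some exponent
below \<open>t\<close>, although the affinity dimension is the infimum of the exponents.\<close>

lemma cut_set_sum_ge_1:
  assumes "cut_set J" "0 \<le> t" "t \<le> affinity_dim N S"
  shows "1 \<le> (\<Sum>w\<in>J. phi t (lin w))"
proof (rule ccontr)
  assume "\<not> ?thesis"
  then obtain M where "\<forall>m. phi_sum_below m t \<le> M" using phi_sum_below_bounded[OF assms(1,2)] by auto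
  then have "eventually (\<lambda>k. phi_sum k t < 1) sequentially"
    using eventually_phi_sum_less_1 assms(2) by blast
  then have "eventually (\<lambda>k. 1 \<le> k \<and> phi_sum k t < 1) sequentially"
    by (intro eventually_conj eventually_ge_at_top)
  then obtain k where k: "1 \<le> k" "phi_sum k t < 1"
    using eventually_happens'[OF sequentially_bot] by blast
  then have "affinity_exponent N S k < t" using assms(2) by (simp add: phi_sum_less_1_iff)
  moreover have "affinity_dim N S \<le> affinity_exponent N S k"
    unfolding affinity_dim_eq using k affinity_exponent_root
    by (intro cInf_lower bdd_belowI[of _ 0]) auto
  ultimately show False using assms(3) by simp
qed

end

section \<open>The inhomogeneous attractor\<close>

locale condensation_IFS = planar_IFS +
  fixes C :: "(real ^ 2) set"
  assumes C: "compact C" "C \<noteq> {}"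
begin

abbreviation F :: "(real ^ 2) set" where "F \<equiv> inhomogeneous_set N S C"

definition hutchinson :: "(real ^ 2) set \<Rightarrow> (real ^ 2) set" where
  "hutchinson X = (\<Union>i\<in>{1..N}. S i ` X) \<union> C"

lemma continuous_letter: "i \<in> {1..N} \<Longrightarrow> continuous_on X (S i)"
  by (erule letter_affine) (auto intro!: continuous_intros)

lemma compact_hutchinson: "compact X \<Longrightarrow> compact (hutchinson X)"
  unfolding hutchinson_def using C(1)
  by (intro compact_Un compact_UN finite_atLeastAtMost compact_continuous_image continuous_letter) auto

text \<open>The set map is monotone and preserves a large disc, so its iterates on that disc decrease to a
compact set. This set is fixed because the letter maps are injective and finitely many: if the only preimage of
a point under each letter is outside some iterate, then one iterate excludes all these preimages.\<close>

lemma hutchinson_fixed_point_exists: "\<exists>X. X \<noteq> {} \<and> compact X \<and> X = hutchinson X"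
proof -
  obtain a where a: "\<And>x. x \<in> C \<Longrightarrow> norm x \<le> a"
    using compact_imp_bounded[OF C(1)] by (auto simp: bounded_iff)
  have "bounded ((\<lambda>i. S i 0) ` {1..N})" by (intro finite_imp_bounded) simp
  then obtain b where "\<forall>x\<in>(\<lambda>i. S i 0) ` {1..N}. norm x \<le> b" unfolding bounded_iff by blast
  then have b: "norm (S i 0) \<le> b" if "i \<in> {1..N}" for i using that by blast
  define R where "R = max a (b / (1 - ratio))"
  have R: "a \<le> R" "b \<le> (1 - ratio) * R"
    using ratio by (simp_all add: R_def max_def field_simps)
  have inv: "hutchinson (cball 0 R) \<subseteq> cball 0 R"
  proof -
    have "norm (S i x) \<le> R" if "i \<in> {1..N}" "norm x \<le> R" for i x
    proof -
      have "norm (S i x) \<le> norm (S i x - S i 0) + norm (S i 0)"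
        using norm_triangle_ineq[of "S i x - S i 0" "S i 0"] by simp
      also have "\<dots> \<le> ratio * R + (1 - ratio) * R"
        using contraction[OF that(1), of x 0] b[OF that(1)] R(2)
          mult_left_mono[OF that(2) less_imp_le[OF ratio(1)]] by simp
      finally show ?thesis by (simp add: algebra_simps)
    qed
    then show ?thesis using a R(1) by (force simp: hutchinson_def)
  qed
  define X where "X n = (hutchinson ^^ n) (cball 0 R)" for n
  have X_Suc: "X (Suc n) = hutchinson (X n)" for n by (simp add: X_def)
  have mono: "hutchinson A \<subseteq> hutchinson B" if "A \<subseteq> B" for A B
    using that by (auto simp: hutchinson_def)
  have dec: "X (Suc n) \<subseteq> X n" for n
    by (induction n) (use inv mono in \<open>simp_all add: X_def\<close>)
  have dec': "X n \<subseteq> X m" if "m \<le> n" for m n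
    using lift_Suc_antimono_le[of X, OF dec that] .
  have comp: "compact (X n)" for n
    by (induction n) (simp_all add: X_def compact_hutchinson)
  have C_X: "C \<subseteq> X n" for n
    using a R(1) by (cases n) (force simp: X_def hutchinson_def)+
  define Y where "Y = (\<Inter>n. X n)"
  have "Y \<noteq> {}" using C_X C(2) unfolding Y_def by blast
  moreover have "compact Y"
  proof -
    have "closed Y" unfolding Y_def using comp by (intro closed_INT ballI compact_imp_closed)
    moreover have "Y = X 0 \<inter> Y" unfolding Y_def by blast
    ultimately show ?thesis using compact_Int_closed[OF comp[of 0]] by metis
  qed
  moreover have "Y = hutchinson Y"
  proof
    show "hutchinson Y \<subseteq> Y"
    proof -
      have "hutchinson Y \<subseteq> X (Suc n)" for n
        unfolding X_Suc by (intro mono) (auto simp: Y_def)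
      then have "hutchinson Y \<subseteq> X n" for n using dec by blast
      then show ?thesis by (auto simp: Y_def)
    qed
    show "Y \<subseteq> hutchinson Y"
    proof
      fix x assume x: "x \<in> Y"
      show "x \<in> hutchinson Y"
      proof (rule ccontr)
        assume not: "x \<notin> hutchinson Y"
        have "\<exists>m. x \<notin> S i ` X m" if i: "i \<in> {1..N}" for i
        proof (rule ccontr)
          assume "\<nexists>m. x \<notin> S i ` X m"
          then have all: "x \<in> S i ` X m" for m by blast
          then obtain z where z: "x = S i z" by blast
          have "inj (S i)" using inj_word_map[of "[i]"] i by simp
          then have "z \<in> X m" for m using all[of m] z by (auto dest: injD)
          then have "z \<in> Y" by (simp add: Y_def)
          then show False using not z i by (auto simp: hutchinson_def)
        qed
        then have "\<forall>i\<in>{1..N}. \<exists>m. x \<notin> S i ` X m" by blast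
        from bchoice[OF this] obtain m where m: "\<And>i. i \<in> {1..N} \<Longrightarrow> x \<notin> S i ` X (m i)" by blast
        define n where "n = (\<Sum>i\<in>{1..N}. m i)"
        have "x \<notin> S i ` X n" if "i \<in> {1..N}" for i
        proof -
          have "m i \<le> n" unfolding n_def using that by (intro member_le_sum) auto
          then show ?thesis using m[OF that] dec' by blast
        qed
        moreover have "x \<in> X (Suc n)" using x by (simp add: Y_def)
        moreover have "x \<notin> C" using not by (simp add: hutchinson_def)
        ultimately show False by (auto simp: X_Suc hutchinson_def)
      qed
    qed
  qed
  ultimately show ?thesis by blast
qed

text \<open>A point of \<open>X\<close> at maximal distance from \<open>Y\<close> is in \<open>C\<close>, hence in \<open>Y\<close>, or is the image under a
contraction of a point of \<open>X\<close>. So the maximal distance is at most \<open>ratio\<close> times itself.\<close>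

lemma hutchinson_fixed_point_subset:
  assumes X: "X \<noteq> {}" "compact X" "X = hutchinson X" and Y: "Y \<noteq> {}" "compact Y" "Y = hutchinson Y"
  shows "X \<subseteq> Y"
proof -
  have "continuous_on X (\<lambda>z. infdist z Y)" by (intro continuous_intros)
  then obtain x where x: "x \<in> X" and max: "\<And>z. z \<in> X \<Longrightarrow> infdist z Y \<le> infdist x Y"
    using continuous_attains_sup[OF X(2,1)] by blast
  have "infdist x Y \<le> ratio * infdist x Y"
  proof (cases "x \<in> C")
    case True
    then have "x \<in> Y" using Y(3) by (auto simp: hutchinson_def)
    then show ?thesis by simp
  next
    case False
    moreover have "x \<in> hutchinson X" using x X(3) by blast
    ultimately obtain i z where i: "i \<in> {1..N}" "z \<in> X" "x = S i z" unfolding hutchinson_def by blast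
    obtain y where y: "y \<in> Y" "infdist z Y = dist z y"
      using infdist_attains_inf[OF compact_imp_closed[OF Y(2)] Y(1)] by metis
    have "S i y \<in> hutchinson Y" using y(1) i(1) unfolding hutchinson_def by blast
    then have "S i y \<in> Y" using Y(3) by blast
    then have "infdist x Y \<le> dist (S i z) (S i y)" unfolding i(3) by (rule infdist_le)
    also have "\<dots> \<le> ratio * infdist z Y" using contraction[OF i(1), of z y] y(2) by (simp add: dist_norm)
    also have "\<dots> \<le> ratio * infdist x Y" using max[OF i(2)] ratio by simp
    finally show ?thesis .
  qed
  then have "infdist x Y \<le> 0" using ratio infdist_nonneg[of x Y] by (smt (verit) mult_less_cancel_right2)
  then have "infdist z Y = 0" if "z \<in> X" for z using max[OF that] infdist_nonneg[of z Y] by simp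
  then show ?thesis using in_closed_iff_infdist_zero[OF compact_imp_closed[OF Y(2)] Y(1)] by blast
qed

lemma F: "F \<noteq> {}" "compact F" "F = (\<Union>i\<in>{1..N}. S i ` F) \<union> C"
proof -
  have "\<exists>!X. X \<noteq> {} \<and> compact X \<and> X = hutchinson X"
    using hutchinson_fixed_point_exists hutchinson_fixed_point_subset by (meson subset_antisym)
  from theI'[OF this] show "F \<noteq> {}" "compact F" "F = (\<Union>i\<in>{1..N}. S i ` F) \<union> C"
    unfolding inhomogeneous_set_def hutchinson_def by auto
qed

lemma bounded_F: "bounded F"
  by (rule compact_imp_bounded[OF F(2)])

lemma C_subset_F: "C \<subseteq> F"
  using F(3) by blast

lemma letter_image_F: "i \<in> {1..N} \<Longrightarrow> x \<in> F \<Longrightarrow> S i x \<in> F"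
  using F(3) by blast

lemma word_image_subset_F: "is_word w \<Longrightarrow> word_map S w ` F \<subseteq> F"
proof (induction w)
  case (Cons i w)
  then have "S i ` word_map S w ` F \<subseteq> S i ` F" by (intro image_mono) auto
  also have "\<dots> \<subseteq> F" using letter_image_F Cons.prems by (intro image_subsetI) auto
  finally show ?case by (simp add: image_comp)
qed simp

section \<open>Upper bound for the upper box dimension\<close>

lemma word_squeeze_length: "is_word w \<Longrightarrow> ratio ^ m < a \<Longrightarrow> a \<le> squeeze (lin w) \<Longrightarrow> length w < m"
  using squeeze_lin_le[of w] power_decreasing[of m "length w" ratio] ratio by (smt (verit) not_less)

text \<open>Follow the letters leading to \<open>x\<close>. This ends, since words of length \<open>k\<close> squeeze to at most
\<open>ratio ^ k\<close>, and one more letter loses at most the factor \<open>letter_squeeze\<close>; this is why the final word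
still squeezes to at least \<open>letter_squeeze * \<delta>\<close>.\<close>

lemma F_decomposition:
  assumes \<delta>: "0 < \<delta>" "\<delta> < 1" and x: "x \<in> F"
  shows "\<exists>w. is_word w \<and> ((\<delta> < squeeze (lin w) \<and> x \<in> word_map S w ` C) \<or>
    (letter_squeeze * \<delta> \<le> squeeze (lin w) \<and> squeeze (lin w) \<le> \<delta> \<and> x \<in> word_map S w ` F))"
proof (rule ccontr)
  assume not: "\<not> ?thesis"
  have "\<exists>w. is_word w \<and> length w = k \<and> \<delta> < squeeze (lin w) \<and> x \<in> word_map S w ` F" for k
  proof (induction k)
    case 0
    then show ?case using \<delta> x by (intro exI[of _ "[]"]) simp
  next
    case (Suc k)
    then obtain w y where w: "is_word w" "length w = k" "\<delta> < squeeze (lin w)" and y: "y \<in> F" "x = word_map S w y"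
      by blast
    have "y \<notin> C" using not w y by blast
    then obtain i z where i: "i \<in> {1..N}" "z \<in> F" "y = S i z" using y(1) F(3) by blast
    have word: "is_word (w @ [i])" using w(1) i(1) by simp
    have x': "x \<in> word_map S (w @ [i]) ` F" using y(2) i by (simp add: word_map_append)
    have "letter_squeeze * \<delta> \<le> letter_squeeze * squeeze (lin w)"
      using w(3) letter_squeeze_pos by simp
    also have "\<dots> \<le> squeeze (lin (w @ [i]))" by (rule squeeze_snoc_ge[OF word])
    finally have "\<delta> < squeeze (lin (w @ [i]))" using not word x' by fastforce
    then show ?case using word x' w(2) by (intro exI[of _ "w @ [i]"]) simp
  qed
  moreover obtain k where "ratio ^ k < \<delta>" using real_arch_pow_inv[OF \<delta>(1) ratio(2)] by blast
  moreover from calculation obtain w where "is_word w" "length w = k" "\<delta> < squeeze (lin w)" by blast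
  ultimately show False using word_squeeze_length[of w k \<delta>] by simp
qed

lemma word_image_subset_affine:
  "is_word w \<Longrightarrow> word_map S w ` E = (\<lambda>x. lin w *v x + word_map S w 0) ` E"
  by (intro image_cong refl word_map_eq)

text \<open>Cover \<open>C\<close> by squares of side \<open>\<delta> / squeeze\<close>. The word map sends each of them into a strip of thickness
about \<open>\<delta>\<close>, which takes about \<open>stretch / squeeze\<close> squares of side \<open>\<delta>\<close>.\<close>

lemma coverable_word_image_C:
  assumes t: "1 \<le> t" "t \<le> 2" and w: "is_word w" and \<delta>: "0 < \<delta>" "\<delta> < squeeze (lin w)"
    and C_cov: "\<And>r. 0 < r \<Longrightarrow> r < 1 \<Longrightarrow> coverable r C (K * r powr (- t))"
  shows "coverable \<delta> (word_map S w ` C) (324 * K * phi t (lin w) * \<delta> powr (- t))"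
proof -
  define r where "r = \<delta> / squeeze (lin w)"
  note inv = invertible_lin[OF w]
  have pos: "0 < squeeze (lin w)" "0 < stretch (lin w)" using squeeze_pos[OF inv] stretch_pos[OF inv] by auto
  have r: "0 < r" "r < 1" using \<delta> pos by (simp_all add: r_def)
  obtain P where P: "finite P" "real (card P) \<le> K * r powr (- t)" "C \<subseteq> (\<Union>a\<in>P. cbox a (a + (\<chi> i. r)))"
    using C_cov[OF r] by (auto simp: coverable_def)
  have sub: "word_map S w ` C \<subseteq> (\<Union>a\<in>P. (\<lambda>x. lin w *v x + word_map S w 0) ` cball a (2 * r))"
    unfolding word_image_subset_affine[OF w] using P(3) cube_subset_cball[of r] r(1) by fastforce
  let ?m = "12 * (real 2 + 1)\<^sup>2 * (stretch (lin w) * (2 * r) / \<delta> + 1)"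
  have "coverable \<delta> ((\<lambda>x. lin w *v x + word_map S w 0) ` cball a (2 * r)) ?m" for a
    using r pos \<delta> by (intro coverable_affine_image_cball inv) (auto simp: r_def)
  then have cov: "coverable \<delta> (\<Union>a\<in>P. (\<lambda>x. lin w *v x + word_map S w 0) ` cball a (2 * r)) (\<Sum>a\<in>P. ?m)"
    by (intro coverable_UN P(1))
  have "?m = 108 * (2 * (stretch (lin w) / squeeze (lin w)) + 1)"
    using \<delta> pos by (simp add: r_def)
  also have "\<dots> \<le> 324 * (stretch (lin w) / squeeze (lin w))"
    using squeeze_le_stretch[OF inv] pos by (simp add: field_simps)
  finally have m: "?m \<le> 324 * (stretch (lin w) / squeeze (lin w))" .
  have "0 \<le> ?m" using pos r \<delta> by simp
  then have "real (card P) * ?m \<le> K * r powr (- t) * (324 * (stretch (lin w) / squeeze (lin w)))"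
    by (rule mult_mono[OF P(2) m order_trans[OF of_nat_0_le_iff P(2)]])
  then have "(\<Sum>a\<in>P. ?m) \<le> K * r powr (- t) * (324 * (stretch (lin w) / squeeze (lin w)))"
    unfolding sum_constant .
  also have "\<dots> = 324 * K * (stretch (lin w) * (squeeze (lin w) powr t / squeeze (lin w))) * \<delta> powr (- t)"
    using \<delta> pos by (simp add: r_def powr_divide powr_minus divide_simps)
  also have "stretch (lin w) * (squeeze (lin w) powr t / squeeze (lin w)) = phi t (lin w)"
    using pos t by (simp add: phi_between_1_2[OF inv] powr_diff)
  finally show ?thesis by (rule coverable_subset[OF cov sub])
qed

text \<open>The image has thickness comparable to \<open>\<delta>\<close>, so about \<open>stretch / \<delta>\<close> squares suffice. As \<open>squeeze\<close> is
comparable to \<open>\<delta>\<close>, this is comparable to \<open>phi t * \<delta> powr (- t)\<close>.\<close>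

lemma coverable_word_image_bounded:
  assumes t: "1 \<le> t" "t \<le> 2" and E: "E \<subseteq> cball 0 (real n)"
  obtains K where "0 < K" "\<And>w \<delta>. is_word w \<Longrightarrow> 0 < \<delta> \<Longrightarrow> letter_squeeze * \<delta> \<le> squeeze (lin w) \<Longrightarrow>
     squeeze (lin w) \<le> \<delta> \<Longrightarrow> coverable \<delta> (word_map S w ` E) (K * phi t (lin w) * \<delta> powr (- t))"
proof -
  define c where "c = letter_squeeze"
  have c: "0 < c" using letter_squeeze_pos by (simp add: c_def)
  define K where "K = 12 * (real n + 1)\<^sup>2 * (real n + 1 / c) * c powr (1 - t)"
  have K: "0 < K" using c by (simp add: K_def add_nonneg_pos)
  have "coverable \<delta> (word_map S w ` E) (K * phi t (lin w) * \<delta> powr (- t))"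
    if w: "is_word w" and \<delta>: "0 < \<delta>" "c * \<delta> \<le> squeeze (lin w)" "squeeze (lin w) \<le> \<delta>" for w \<delta>
  proof -
    note inv = invertible_lin[OF w]
    have pos: "0 < squeeze (lin w)" "0 < stretch (lin w)" using squeeze_pos[OF inv] stretch_pos[OF inv] by auto
    have cov: "coverable \<delta> ((\<lambda>x. lin w *v x + word_map S w 0) ` cball 0 (real n))
        (12 * (real n + 1)\<^sup>2 * (stretch (lin w) * real n / \<delta> + 1))"
      using \<delta> mult_right_mono[OF \<delta>(3), of "real n"]
      by (intro coverable_affine_image_cball inv) (simp_all add: mult.commute)
    have sub: "word_map S w ` E \<subseteq> (\<lambda>x. lin w *v x + word_map S w 0) ` cball 0 (real n)"
      unfolding word_image_subset_affine[OF w] using E by (rule image_mono)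
    have "c * \<delta> \<le> stretch (lin w)" using squeeze_le_stretch[OF inv] \<delta> by simp
    then have "stretch (lin w) * real n / \<delta> + 1 \<le> (real n + 1 / c) * (stretch (lin w) / \<delta>)"
      using c \<delta>(1) by (simp add: field_simps)
    also have "stretch (lin w) / \<delta> \<le> c powr (1 - t) * phi t (lin w) * \<delta> powr (- t)"
    proof -
      have "(c * \<delta>) powr (t - 1) \<le> squeeze (lin w) powr (t - 1)"
        using \<delta> c t by (intro powr_mono2) auto
      then have "stretch (lin w) * (c * \<delta>) powr (t - 1) \<le> phi t (lin w)"
        using pos t by (simp add: phi_between_1_2[OF inv])
      then have "c powr (1 - t) * (stretch (lin w) * (c * \<delta>) powr (t - 1)) * \<delta> powr (- t) \<le>
          c powr (1 - t) * phi t (lin w) * \<delta> powr (- t)"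
        by (intro mult_left_mono mult_right_mono) auto
      also have "c powr (1 - t) * (stretch (lin w) * (c * \<delta>) powr (t - 1)) * \<delta> powr (- t) =
          stretch (lin w) * (c powr (1 - t) * c powr (t - 1)) * (\<delta> powr (t - 1) * \<delta> powr (- t))"
        using c \<delta>(1) by (simp add: powr_mult)
      also have "c powr (1 - t) * c powr (t - 1) = 1" using c by (simp flip: powr_add)
      also have "\<delta> powr (t - 1) * \<delta> powr (- t) = 1 / \<delta>"
        using \<delta>(1) by (simp add: powr_diff powr_minus)
      finally show ?thesis by simp
    qed
    finally have "stretch (lin w) * real n / \<delta> + 1 \<le>
        (real n + 1 / c) * (c powr (1 - t) * phi t (lin w) * \<delta> powr (- t))"
      using c by (simp add: mult_left_mono)
    then have "12 * (real n + 1)\<^sup>2 * (stretch (lin w) * real n / \<delta> + 1) \<le>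
        12 * (real n + 1)\<^sup>2 * ((real n + 1 / c) * (c powr (1 - t) * phi t (lin w) * \<delta> powr (- t)))"
      by (intro mult_left_mono) auto
    also have "\<dots> = K * phi t (lin w) * \<delta> powr (- t)" by (simp add: K_def mult_ac)
    finally show ?thesis by (rule coverable_subset[OF cov sub])
  qed
  then show thesis using that K by (auto simp: c_def)
qed

text \<open>Every piece of the decomposition at scale \<open>\<delta>\<close> costs a constant times \<open>phi t * \<delta> powr (- t)\<close>
squares, and the sum of \<open>phi t\<close> over all words is finite.\<close>

lemma upper_box_dim_F_le:
  assumes t: "1 \<le> t" "t \<le> 2" and s: "affinity_dim N S < t" and dim: "upper_box_dim C < ereal t"
  shows "upper_box_dim F \<le> ereal t"
proof -
  obtain KC where KC: "0 < KC" "\<And>\<delta>. 0 < \<delta> \<Longrightarrow> \<delta> < 1 \<Longrightarrow> coverable \<delta> C (KC * \<delta> powr (- t))"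
    using coverable_of_upper_box_dim_less[OF compact_imp_bounded[OF C(1)] C(2) _ dim] t by auto
  obtain R where R: "F \<subseteq> ball 0 R" using bounded_subset_ballD[OF bounded_F] by blast
  obtain n :: nat where "R \<le> real n" using real_arch_simple by blast
  then have "F \<subseteq> cball 0 (real n)" using R by force
  then obtain KF where KF: "0 < KF" "\<And>w \<delta>. is_word w \<Longrightarrow> 0 < \<delta> \<Longrightarrow> letter_squeeze * \<delta> \<le> squeeze (lin w) \<Longrightarrow>
     squeeze (lin w) \<le> \<delta> \<Longrightarrow> coverable \<delta> (word_map S w ` F) (KF * phi t (lin w) * \<delta> powr (- t))"
    using coverable_word_image_bounded[OF t] by metis
  obtain M where M: "\<And>m. phi_sum_below m t \<le> M"
    using phi_sum_below_bounded_above_affinity_dim[OF s] by blast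
  define K where "K = 324 * KC + KF"
  have K: "0 < K" "324 * KC \<le> K" "KF \<le> K" using KC(1) KF(1) by (simp_all add: K_def)
  show ?thesis
  proof (rule upper_box_dim_le[OF bounded_F F(1)])
    show "0 < K * max M 1" using K by simp
    fix \<delta> :: real assume \<delta>: "0 < \<delta>" "\<delta> < 1"
    \<comment> \<open>Words that squeeze to less than \<open>letter_squeeze * \<delta>\<close> do not occur in the decomposition.\<close>
    define E where "E w = (if \<delta> < squeeze (lin w) then word_map S w ` C
      else if letter_squeeze * \<delta> \<le> squeeze (lin w) then word_map S w ` F else {})" for w
    \<comment> \<open>A length that no word of the decomposition reaches.\<close>
    obtain m where m: "ratio ^ m < min \<delta> (letter_squeeze * \<delta>)"
      using real_arch_pow_inv[of "min \<delta> (letter_squeeze * \<delta>)" ratio] ratio \<delta> letter_squeeze_pos by auto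
    have "coverable \<delta> (\<Union>w\<in>words_below N m. E w) (\<Sum>w\<in>words_below N m. K * phi t (lin w) * \<delta> powr (- t))"
    proof (rule coverable_UN[OF finite_words_below])
      fix w assume "w \<in> words_below N m"
      then have w: "is_word w" by (simp add: words_below_def)
      have nonneg: "0 \<le> phi t (lin w) * \<delta> powr (- t)" using phi_lin_pos[OF w, of t] t by simp
      have le: "K' * phi t (lin w) * \<delta> powr (- t) \<le> K * phi t (lin w) * \<delta> powr (- t)" if "K' \<le> K" for K'
        using mult_right_mono[OF that nonneg] by (simp add: mult.assoc)
      consider "\<delta> < squeeze (lin w)" | "squeeze (lin w) \<le> \<delta>" "letter_squeeze * \<delta> \<le> squeeze (lin w)"
        | "squeeze (lin w) \<le> \<delta>" "squeeze (lin w) < letter_squeeze * \<delta>" by linarith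
      then show "coverable \<delta> (E w) (K * phi t (lin w) * \<delta> powr (- t))"
      proof cases
        case 1
        then show ?thesis
          using coverable_subset[OF coverable_word_image_C[OF t w \<delta>(1) 1 KC(2)] order_refl le[OF K(2)]]
          by (simp add: E_def)
      next
        case 2
        then show ?thesis
          using coverable_subset[OF KF(2)[OF w \<delta>(1) 2(2,1)] order_refl le[OF K(3)]] by (simp add: E_def)
      next
        case 3
        then have "E w = {}" by (simp add: E_def)
        then show ?thesis using nonneg K(1) unfolding coverable_def by (intro exI[of _ "{}"]) (simp add: mult.assoc)
      qed
    qed
    moreover have "F \<subseteq> (\<Union>w\<in>words_below N m. E w)"
    proof
      fix x assume "x \<in> F"
      from F_decomposition[OF \<delta> this] obtain w where w: "is_word w" and
        cases: "(\<delta> < squeeze (lin w) \<and> x \<in> word_map S w ` C) \<or>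
          (letter_squeeze * \<delta> \<le> squeeze (lin w) \<and> squeeze (lin w) \<le> \<delta> \<and> x \<in> word_map S w ` F)" by blast
      then have "length w < m" using word_squeeze_length[OF w m] by auto
      then have "w \<in> words_below N m" using w by (simp add: words_below_def)
      moreover have "x \<in> E w" using cases by (auto simp: E_def)
      ultimately show "x \<in> (\<Union>w\<in>words_below N m. E w)" by blast
    qed
    moreover have "(\<Sum>w\<in>words_below N m. K * phi t (lin w) * \<delta> powr (- t)) \<le> K * max M 1 * \<delta> powr (- t)"
    proof -
      have "(\<Sum>w\<in>words_below N m. K * phi t (lin w) * \<delta> powr (- t)) = K * phi_sum_below m t * \<delta> powr (- t)"
        by (simp add: phi_sum_below_def sum_distrib_left sum_distrib_right)
      also have "\<dots> \<le> K * max M 1 * \<delta> powr (- t)"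
        using M[of m] K(1) by (intro mult_right_mono mult_left_mono) auto
      finally show ?thesis .
    qed
    ultimately show "coverable \<delta> F (K * max M 1 * \<delta> powr (- t))" by (rule coverable_subset)
  qed
qed

lemma upper_box_dim_F_le_2: "upper_box_dim F \<le> 2"
proof -
  obtain K where K: "0 < K" "\<And>\<delta>. 0 < \<delta> \<Longrightarrow> \<delta> \<le> 1 \<Longrightarrow> coverable \<delta> F (K / \<delta>\<^sup>2)"
    using coverable_bounded[OF bounded_F] by metis
  have "upper_box_dim F \<le> ereal 2"
  proof (rule upper_box_dim_le[OF bounded_F F(1) K(1)])
    fix \<delta> :: real assume "0 < \<delta>" "\<delta> < 1"
    then show "coverable \<delta> F (K * \<delta> powr (- 2))"
      using K(2)[of \<delta>] by (simp add: powr_minus divide_inverse)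
  qed
  then show ?thesis by simp
qed

section \<open>Lower bound for the lower box dimension\<close>

definition stopping :: "real \<Rightarrow> nat list set" where
  "stopping \<delta> = {w. is_word w \<and> w \<noteq> [] \<and> squeeze (lin w) \<le> \<delta> \<and> \<delta> < squeeze (lin (butlast w))}"

text \<open>Words of length \<open>m\<close> squeeze below \<open>\<delta>\<close> once \<open>ratio ^ m < \<delta>\<close>, so each is stopped at its shortest
prefix that does. The empty word does not, because \<open>\<delta> < 1\<close>.\<close>

lemma cut_set_stopping:
  assumes \<delta>: "0 < \<delta>" "\<delta> < 1"
  shows "cut_set (stopping \<delta>)"
proof -
  obtain m where m: "ratio ^ m < \<delta>" using real_arch_pow_inv[OF \<delta>(1) ratio(2)] by blast
  have "stopping \<delta> \<subseteq> words_below N (Suc m)"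
  proof
    fix w assume "w \<in> stopping \<delta>"
    then have w: "is_word w" "\<delta> < squeeze (lin (butlast w))" by (auto simp: stopping_def)
    then have "is_word (butlast w)" by (meson in_set_butlastD subset_iff)
    then have "length (butlast w) < m" by (rule word_squeeze_length[OF _ m less_imp_le[OF w(2)]])
    then show "w \<in> words_below N (Suc m)" using w(1) by (simp add: words_below_def)
  qed
  then have "finite (stopping \<delta>)" using finite_words_below finite_subset by blast
  moreover have "\<exists>j\<in>stopping \<delta>. \<exists>v. w = j @ v" if w: "is_word w" "m \<le> length w" for w
  proof -
    have ex: "squeeze (lin (take (length w) w)) \<le> \<delta>"
      using word_squeeze_length[OF w(1) m] w(2) by force
    define k where "k = (LEAST k. squeeze (lin (take k w)) \<le> \<delta>)"
    have k: "squeeze (lin (take k w)) \<le> \<delta>" "k \<le> length w"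
      unfolding k_def using ex
      by (rule LeastI[of "\<lambda>k. squeeze (lin (take k w)) \<le> \<delta>"])
         (rule Least_le[of "\<lambda>k. squeeze (lin (take k w)) \<le> \<delta>", OF ex])
    have "k \<noteq> 0" using k(1) \<delta> by (cases k) auto
    moreover have "\<delta> < squeeze (lin (take (k - 1) w))"
      using not_less_Least[of "k - 1" "\<lambda>k. squeeze (lin (take k w)) \<le> \<delta>"] \<open>k \<noteq> 0\<close> unfolding k_def[symmetric] by simp
    moreover have "is_word (take k w)" using w(1) set_take_subset[of k w] by blast
    ultimately have "take k w \<in> stopping \<delta>"
      using k by (auto simp: stopping_def butlast_take)
    then show ?thesis by (metis append_take_drop_id)
  qed
  ultimately show ?thesis unfolding cut_set_def by (auto simp: stopping_def)
qed

lemma stopping_prefix_free: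
  assumes "v \<in> stopping \<delta>" "w \<in> stopping \<delta>" "prefix v w"
  shows "v = w"
proof (rule ccontr)
  assume "v \<noteq> w"
  then obtain u where u: "w = v @ u" "u \<noteq> []" using assms(3) by (auto simp: prefix_def)
  then have "butlast w = v @ butlast u" by (simp add: butlast_append)
  moreover have "is_word v" "is_word (butlast u)"
    using assms(1,2) u by (auto simp: stopping_def dest: in_set_butlastD)
  ultimately have "squeeze (lin (butlast w)) \<le> squeeze (lin v)" using squeeze_append_le by simp
  then show False using assms by (simp add: stopping_def)
qed

lemma squeeze_stopping_ge:
  assumes "w \<in> stopping \<delta>"
  shows "letter_squeeze * \<delta> \<le> squeeze (lin w)"
proof -
  have w: "w \<noteq> []" "is_word w" "\<delta> < squeeze (lin (butlast w))" using assms by (auto simp: stopping_def)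
  have "letter_squeeze * \<delta> \<le> letter_squeeze * squeeze (lin (butlast w))"
    using w(3) letter_squeeze_pos by simp
  also have "\<dots> \<le> squeeze (lin w)"
    using squeeze_snoc_ge[of "butlast w" "last w"] w by simp
  finally show ?thesis .
qed

text \<open>Use the functional \<open>z \<mapsto> e \<bullet> z\<close> with \<open>e\<close> the long axis of the image ellipse. Pulled back by the word
map it is a functional of norm at least \<open>stretch\<close>, and \<open>K\<close> has width at least \<open>L\<close> for unit
functionals.\<close>

lemma word_image_separated_points:
  assumes K: "connected K" and width: "\<And>v. \<exists>x\<in>K. \<exists>y\<in>K. L * norm v \<le> v \<bullet> (y - x)" and L: "0 < L"
    and w: "is_word w" and h: "0 < h"
  shows "\<exists>X. finite X \<and> X \<subseteq> word_map S w ` K \<and> L * stretch (lin w) / h \<le> real (card X) \<and>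
    (\<forall>u\<in>X. \<forall>v\<in>X. u \<noteq> v \<longrightarrow> h \<le> dist u v)"
proof -
  obtain e where e: "norm e = 1" "stretch (lin w) \<le> norm (transpose (lin w) *v e)"
    using matrix_image_in_strip[OF invertible_lin[OF w]] by metis
  obtain x y where xy: "x \<in> K" "y \<in> K" "L * norm (transpose (lin w) *v e) \<le> (transpose (lin w) *v e) \<bullet> (y - x)"
    using width by blast
  have "L * stretch (lin w) \<le> L * norm (transpose (lin w) *v e)" using e L by simp
  also have "\<dots> \<le> e \<bullet> (lin w *v (y - x))"
    using xy(3) by (simp add: inner_2 mult_vec_2 transpose_def algebra_simps)
  also have "\<dots> = e \<bullet> word_map S w y - e \<bullet> word_map S w x"
    by (simp add: word_map_eq[OF w, of x] word_map_eq[OF w, of y] matrix_vector_mult_diff_distrib inner_simps)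
  finally have l: "L * stretch (lin w) \<le> e \<bullet> word_map S w y - e \<bullet> word_map S w x" .
  have cont: "continuous_on K (word_map S w)"
    by (rule continuous_on_eq[of _ "\<lambda>x. lin w *v x + word_map S w 0"])
       (auto intro!: continuous_intros, metis word_map_eq[OF w])
  have lip: "\<bar>e \<bullet> u - e \<bullet> v\<bar> \<le> dist u v" for u v
    using Cauchy_Schwarz_ineq2[of e "u - v"] e by (simp add: inner_diff_right dist_norm)
  have "continuous_on (word_map S w ` K) (\<lambda>z. e \<bullet> z)" by (intro continuous_intros)
  moreover have "0 \<le> L * stretch (lin w)" using L stretch_nonneg by simp
  ultimately show ?thesis
    by (rule connected_separated_points[OF connected_continuous_image[OF cont K]
          imageI[OF xy(1)] imageI[OF xy(2)] _ lip l _ h])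
qed

text \<open>The case of the empty word: \<open>K\<close> itself contains about \<open>1 / \<delta>\<close> points that are \<open>\<delta>\<close>-separated.\<close>

lemma lower_box_dim_C_ge_1:
  assumes K: "connected K" "\<not> collinear K" "K \<subseteq> C"
  shows "1 \<le> lower_box_dim C"
proof -
  obtain L where L: "0 < L" "\<And>v. \<exists>x\<in>K. \<exists>y\<in>K. L * norm v \<le> v \<bullet> (y - x)"
    using not_collinear_width[OF K(2)] by metis
  have "ereal 1 \<le> lower_box_dim C"
  proof (rule lower_box_dim_ge)
    show "0 < L / 2" using L by simp
    show "(0 :: real) < 1" by simp
    fix \<delta> :: real assume \<delta>: "0 < \<delta>" "\<delta> < 1"
    obtain X where X: "X \<subseteq> K" "L * 1 / (2 * \<delta>) \<le> real (card X)" "\<forall>u\<in>X. \<forall>v\<in>X. u \<noteq> v \<longrightarrow> 2 * \<delta> \<le> dist u v"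
      using word_image_separated_points[OF K(1) L(2,1), of "[]" "2 * \<delta>"] \<delta> by auto
    have "card X \<le> covering_number \<delta> C"
    proof (rule card_separated_le_covering_number[OF compact_imp_bounded[OF C(1)] \<delta>(1)])
      show "\<delta> \<le> 1" "X \<subseteq> C" using \<delta>(2) X(1) K(3) by auto
    qed (use X(3) in blast)
    then have "L * 1 / (2 * \<delta>) \<le> real (covering_number \<delta> C)" using X(2) by linarith
    then show "L / 2 * \<delta> powr - 1 \<le> real (covering_number \<delta> C)"
      unfolding powr_neg_one[OF \<delta>(1)] by simp
  qed
  then show ?thesis unfolding one_ereal_def .
qed

text \<open>The image of a disc of radius \<open>\<rho>\<close> contains a disc whose radius is \<open>squeeze\<close> times \<open>\<rho>\<close>. So a point \<open>y\<close>
closer than that to \<open>x\<close> lies in the image of \<open>U\<close> under both words. The two words are incomparable,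
thus the images of \<open>U\<close> are separated at the first letter where the words differ.\<close>

lemma stopping_word_images_separated:
  assumes U: "\<forall>i\<in>{1..N}. S i ` U \<subseteq> U" "\<forall>i\<in>{1..N}. \<forall>j\<in>{1..N}. i \<noteq> j \<longrightarrow> S i ` U \<inter> S j ` U = {}"
    and \<rho>: "0 < \<rho>" "(\<Union>x\<in>C. ball x \<rho>) \<subseteq> U"
    and vw: "v \<in> stopping \<delta>" "w \<in> stopping \<delta>" "v \<noteq> w"
    and xy: "x \<in> word_map S v ` C" "y \<in> word_map S w ` C"
  shows "squeeze (lin v) * \<rho> \<le> dist x y"
proof (rule ccontr)
  assume less: "\<not> ?thesis"
  have words: "is_word v" "is_word w" using vw by (auto simp: stopping_def)
  note inv = invertible_lin[OF words(1)]
  obtain x' y' where x': "x' \<in> C" "x = word_map S v x'" and y': "y' \<in> C" "y = word_map S w y'" using xy by blast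
  obtain z where z: "lin v *v z = y - x"
    using inv by (metis invertible_def matrix_vector_mul_assoc matrix_vector_mul_lid)
  have "squeeze (lin v) * norm z < squeeze (lin v) * \<rho>"
    using squeeze_norm_le[OF inv, of z] less z by (simp add: dist_norm norm_minus_commute)
  then have "norm z < \<rho>" using squeeze_pos[OF inv] by simp
  then have "x' + z \<in> ball x' \<rho>" by (simp add: dist_norm)
  then have "x' + z \<in> U" using x'(1) \<rho>(2) by blast
  moreover have "y = word_map S v (x' + z)"
    using word_map_eq[OF words(1), of x'] word_map_eq[OF words(1), of "x' + z"] z x'(2)
    by (simp add: matrix_vector_right_distrib)
  ultimately have yv: "y \<in> word_map S v ` U" by blast
  have "y' \<in> U" using y'(1) \<rho> by (metis UN_I centre_in_ball subsetD)
  then have yw: "y \<in> word_map S w ` U" using y' by blast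
  have "v \<parallel> w" using vw stopping_prefix_free by blast
  then obtain p i v' j w' where p: "i \<noteq> j" "v = p @ i # v'" "w = p @ j # w'"
    using parallel_decomp by blast
  have into: "word_map S u ` U \<subseteq> U" if "is_word u" for u
    using that by (induction u) (use U(1) in \<open>fastforce simp: image_subset_iff\<close>)+
  have ij: "is_word p" "i \<in> {1..N}" "j \<in> {1..N}" "is_word v'" "is_word w'" using words p by auto
  have "y \<in> word_map S p ` S i ` U" "y \<in> word_map S p ` S j ` U"
    using yv yw into[OF ij(4)] into[OF ij(5)] unfolding p by (auto simp: word_map_append)
  then obtain a b where "a \<in> S i ` U" "b \<in> S j ` U" "word_map S p a = word_map S p b" by auto
  moreover from this have "a = b" using inj_word_map[OF ij(1)] by (meson injD)
  ultimately show False using U(2) ij p(1) by blast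
qed

text \<open>The separated points of all stopped words are jointly separated, so a square can hold only one
of them. A stopped word contributes about \<open>stretch / \<delta>\<close> points, and this is at least
\<open>phi t * \<delta> powr (- t)\<close> because \<open>squeeze \<le> \<delta>\<close>.\<close>

lemma lower_box_dim_F_ge:
  assumes K: "connected K" "\<not> collinear K" "K \<subseteq> C" and cosc: "COSC N S C"
    and t: "1 \<le> t" "t \<le> 2" "t \<le> affinity_dim N S"
  shows "ereal t \<le> lower_box_dim F"
proof -
  obtain L where L: "0 < L" "\<And>v. \<exists>x\<in>K. \<exists>y\<in>K. L * norm v \<le> v \<bullet> (y - x)"
    using not_collinear_width[OF K(2)] by metis
  from cosc[unfolded COSC_def] obtain U where "open U" and C_U: "C \<subseteq> U - (\<Union>i\<in>{1..N}. closure (S i ` U))"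
      and U: "\<forall>i\<in>{1..N}. S i ` U \<subseteq> U" "\<forall>i\<in>{1..N}. \<forall>j\<in>{1..N}. i \<noteq> j \<longrightarrow> S i ` U \<inter> S j ` U = {}"
    by (elim exE conjE)
  have "C \<subseteq> U" using C_U by (rule subset_trans) (rule Diff_subset)
  obtain \<rho> where \<rho>: "0 < \<rho>" "(\<Union>x\<in>C. ball x \<rho>) \<subseteq> U"
    using compact_subset_open_imp_ball_epsilon_subset[OF C(1) \<open>open U\<close> \<open>C \<subseteq> U\<close>] by blast
  define \<kappa> where "\<kappa> = letter_squeeze * \<rho>"
  have \<kappa>: "0 < \<kappa>" using letter_squeeze_pos \<rho>(1) by (simp add: \<kappa>_def)
  show ?thesis
  proof (rule lower_box_dim_ge)
    show "0 < L / 2 * (2 / \<kappa>) powr (1 - t)" using L \<kappa> by simp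
    show "0 < min 1 (\<kappa> / 2)" using \<kappa> by simp
    fix \<eta> :: real assume \<eta>: "0 < \<eta>" "\<eta> < min 1 (\<kappa> / 2)"
    \<comment> \<open>The stopping scale for which the separation \<open>\<kappa> * \<delta>\<close> between different words is exactly twice the
      side of the squares.\<close>
    define \<delta> where "\<delta> = 2 * \<eta> / \<kappa>"
    have \<delta>: "0 < \<delta>" "\<delta> < 1" "\<kappa> * \<delta> = 2 * \<eta>" using \<eta> \<kappa> by (simp_all add: \<delta>_def field_simps)
    have words: "is_word w" if "w \<in> stopping \<delta>" for w using that by (simp add: stopping_def)
    have "\<forall>w\<in>stopping \<delta>. \<exists>X. finite X \<and> X \<subseteq> word_map S w ` K \<and> L * stretch (lin w) / (2 * \<eta>) \<le> real (card X) \<and>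
        (\<forall>u\<in>X. \<forall>v\<in>X. u \<noteq> v \<longrightarrow> 2 * \<eta> \<le> dist u v)"
      using words \<eta>(1) by (intro ballI word_image_separated_points K L) auto
    from bchoice[OF this] obtain X where X: "\<forall>w\<in>stopping \<delta>. finite (X w) \<and> X w \<subseteq> word_map S w ` K \<and>
        L * stretch (lin w) / (2 * \<eta>) \<le> real (card (X w)) \<and> (\<forall>u\<in>X w. \<forall>v\<in>X w. u \<noteq> v \<longrightarrow> 2 * \<eta> \<le> dist u v)"
      by (rule exE)
    have fin: "finite (X w)" and sub: "X w \<subseteq> word_map S w ` K"
      and card: "L * stretch (lin w) / (2 * \<eta>) \<le> real (card (X w))"
      and sep: "\<And>u v. u \<in> X w \<Longrightarrow> v \<in> X w \<Longrightarrow> u \<noteq> v \<Longrightarrow> 2 * \<eta> \<le> dist u v" if "w \<in> stopping \<delta>" for w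
      using bspec[OF X that] by simp_all
    have cross: "2 * \<eta> \<le> dist x y" if vw: "v \<in> stopping \<delta>" "w \<in> stopping \<delta>" "v \<noteq> w" and xy: "x \<in> X v" "y \<in> X w" for v w x y
    proof -
      have "2 * \<eta> = letter_squeeze * \<delta> * \<rho>" unfolding \<delta>(3)[symmetric] \<kappa>_def by (simp add: mult_ac)
      also have "\<dots> \<le> squeeze (lin v) * \<rho>"
        using squeeze_stopping_ge[OF vw(1)] \<rho>(1) by (intro mult_right_mono) auto
      also have "\<dots> \<le> dist x y"
        using sub[OF vw(1)] sub[OF vw(2)] xy K(3) by (intro stopping_word_images_separated[OF U \<rho> vw]) blast+
      finally show ?thesis .
    qed
    have fin_stop: "finite (stopping \<delta>)" using cut_set_stopping[OF \<delta>(1,2)] by (simp add: cut_set_def)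
    have "L / 2 * (2 / \<kappa>) powr (1 - t) * \<eta> powr (- t) = L / (2 * \<eta>) * \<delta> powr (1 - t) * 1"
    proof -
      have "\<delta> powr (1 - t) = (2 / \<kappa>) powr (1 - t) * \<eta> powr (1 - t)"
        using \<eta> \<kappa> by (simp add: \<delta>_def flip: powr_mult)
      then show ?thesis using \<eta>(1) by (simp add: powr_diff powr_minus field_simps)
    qed
    also have "\<dots> \<le> L / (2 * \<eta>) * \<delta> powr (1 - t) * (\<Sum>w\<in>stopping \<delta>. phi t (lin w))"
      using cut_set_sum_ge_1[OF cut_set_stopping[OF \<delta>(1,2)]] t L \<eta>(1) by (intro mult_left_mono) auto
    also have "\<dots> = (\<Sum>w\<in>stopping \<delta>. L / (2 * \<eta>) * (\<delta> powr (1 - t) * phi t (lin w)))"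
      by (simp add: sum_distrib_left mult.assoc)
    also have "\<dots> \<le> (\<Sum>w\<in>stopping \<delta>. real (card (X w)))"
    proof (rule sum_mono)
      fix w assume w: "w \<in> stopping \<delta>"
      note inv = invertible_lin[OF words[OF w]]
      have pos: "0 < squeeze (lin w)" "0 < stretch (lin w)" using squeeze_pos[OF inv] stretch_pos[OF inv] by auto
      have "squeeze (lin w) powr (t - 1) \<le> \<delta> powr (t - 1)"
        using w pos t by (intro powr_mono2) (auto simp: stopping_def)
      then have "\<delta> powr (1 - t) * phi t (lin w) \<le> \<delta> powr (1 - t) * (stretch (lin w) * \<delta> powr (t - 1))"
        using pos t by (intro mult_left_mono) (auto simp: phi_between_1_2[OF inv])
      also have "\<dots> = stretch (lin w) * (\<delta> powr (1 - t) * \<delta> powr (t - 1))" by simp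
      also have "\<dots> = stretch (lin w)" using \<delta>(1) by (simp flip: powr_add)
      finally have "L / (2 * \<eta>) * (\<delta> powr (1 - t) * phi t (lin w)) \<le> L / (2 * \<eta>) * stretch (lin w)"
        using L(1) \<eta>(1) by (intro mult_left_mono) auto
      also have "\<dots> \<le> real (card (X w))" using card[OF w] by simp
      finally show "L / (2 * \<eta>) * (\<delta> powr (1 - t) * phi t (lin w)) \<le> real (card (X w))" .
    qed
    also have "\<dots> = real (card (\<Union>w\<in>stopping \<delta>. X w))"
    proof -
      have "X v \<inter> X w = {}" if "v \<in> stopping \<delta>" "w \<in> stopping \<delta>" "v \<noteq> w" for v w
        using cross[OF that] \<eta>(1) by fastforce
      then show ?thesis using fin fin_stop by (simp add: card_UN_disjoint)
    qed
    also have "\<dots> \<le> real (covering_number \<eta> F)"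
    proof (intro of_nat_mono card_separated_le_covering_number[OF bounded_F \<eta>(1)])
      show "\<eta> \<le> 1" using \<eta> by simp
      show "(\<Union>w\<in>stopping \<delta>. X w) \<subseteq> F"
        using sub words word_image_subset_F K(3) C_subset_F by blast
      show "2 * \<eta> \<le> dist x y" if "x \<in> (\<Union>w\<in>stopping \<delta>. X w)" "y \<in> (\<Union>w\<in>stopping \<delta>. X w)" "x \<noteq> y" for x y
        using that sep cross by blast
    qed
    finally show "L / 2 * (2 / \<kappa>) powr (1 - t) * \<eta> powr (- t) \<le> real (covering_number \<eta> F)" .
  qed
qed

end

section \<open>Box dimensions of planar inhomogeneous self-affine sets\<close>

theorem corollary2p5:
  fixes N :: nat and S :: "nat \<Rightarrow> real ^ 2 \<Rightarrow> real ^ 2" and C :: "(real ^ 2) set"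
  defines "s \<equiv> affinity_dim N S" and "F \<equiv> inhomogeneous_set N S C"
  assumes "affine_IFS N S"
    and "s \<le> 2"
    and "C \<noteq> {}" and "compact C"
    and "COSC N S C"
    and "\<exists>K\<in>components C. \<not> collinear K"
  shows "upper_box_dim F = max (ereal s) (upper_box_dim C) \<and>
    max (ereal s) (lower_box_dim C) \<le> lower_box_dim F \<and>
    lower_box_dim F \<le> max (ereal s) (upper_box_dim C)"
proof -
  interpret condensation_IFS N S C
    using assms by unfold_locales auto
  obtain K where K: "connected K" "\<not> collinear K" "K \<subseteq> C"
    using assms(8) in_components_connected in_components_subset by blast
  have C1: "1 \<le> lower_box_dim C" by (rule lower_box_dim_C_ge_1[OF K])
  have low_mono: "lower_box_dim C \<le> lower_box_dim F"
    unfolding F_def using lower_box_dim_mono[OF bounded_F C_subset_F C(2)] .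
  have up_mono: "upper_box_dim C \<le> upper_box_dim F"
    unfolding F_def using upper_box_dim_mono[OF bounded_F C_subset_F C(2)] .
  have s_le: "ereal s \<le> lower_box_dim F"
  proof (cases "1 \<le> s")
    case True
    then show ?thesis
      using lower_box_dim_F_ge[OF K assms(7), of s] assms(4) by (simp add: s_def F_def)
  next
    case False
    then have "ereal s \<le> 1" by simp
    then show ?thesis using C1 low_mono by (meson order_trans)
  qed
  have up: "upper_box_dim F \<le> max (ereal s) (upper_box_dim C)"
  proof (rule ccontr)
    assume "\<not> ?thesis"
    then obtain t where t: "max (ereal s) (upper_box_dim C) < ereal t" "ereal t < upper_box_dim F"
      using ereal_dense2[of "max (ereal s) (upper_box_dim C)"] by (auto simp: not_le)
    have "1 \<le> upper_box_dim C" using C1 lower_le_upper_box_dim by (rule order_trans)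
    then have "1 < ereal t" using t(1) by (metis max.strict_boundedE order_le_less_trans)
    moreover have "ereal t < 2" using t(2) upper_box_dim_F_le_2 unfolding F_def by (rule less_le_trans)
    ultimately have "1 \<le> t" "t \<le> 2" by (simp_all add: one_ereal_def)
    then have "upper_box_dim F \<le> ereal t"
      using upper_box_dim_F_le[of t] t(1) by (simp add: F_def s_def)
    with t(2) show False by simp
  qed
  have low_up: "lower_box_dim F \<le> upper_box_dim F" by (rule lower_le_upper_box_dim)
  have "max (ereal s) (upper_box_dim C) \<le> upper_box_dim F"
    using order_trans[OF s_le low_up] up_mono by (rule max.boundedI)
  then have "upper_box_dim F = max (ereal s) (upper_box_dim C)" using up by (rule antisym[rotated])
  then show ?thesis using max.boundedI[OF s_le low_mono] order_trans[OF low_up up] by blast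
qed

end
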